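(* Generic two-boson Gaussian pentachoron weights with the same multiplicative 2-cocycle $\omega$ are gauge equivalent. That is, there is a nonempty Zariski-open subset $\mathcal U$ of the space of complex symmetric $10\times10$ matrices such that, for any $F,F'\in\mathcal U$ with the same cocycle $\omega$, there is an element of $\mathrm{Sp}(4,\mathbb C)^{\times5}$ mapping the Lagrangian subspace $V_L(F)\subset V_u$ onto $V_L(F')$.
   Context: Let $u=12345$ be a pentachoron (4-simplex); its tetrahedra $t$ are the 4-element subsets and its edges $b=ij$ the 2-element subsets of $\{1,\dots,5\}$. To each tetrahedron $t$ attach two complex variables $x_t,y_t$ and the 4-dimensional space of operators $V_t=\mathrm{span}_{\mathbb C}\{\partial/\partial x_t,\partial/\partial y_t,x_t,y_t\}$, with symplectic product given by the commutator. Let $V_u=\bigoplus_{t\subset u}V_t$ (20-dimensional). The gauge group $\mathrm{Sp}(4,\mathbb C)^{\times5}$ acts on $V_u$, one factor on each $V_t$; Lagrangian subspaces (or the corresponding weights) in one orbit are called gauge equivalent. A symmetric $10\times10$ matrix $F$ (indexed by the ten variables, listed as $z_1,\dots,z_{10}$) determines the weight $\exp(-\tfrac12\sum_{p,q}F_{pq}z_pz_q)$ and the Lagrangian subspace $V_L=V_L(F)\subset V_u$ spanned by the ten operators $\partial/\partial z_p+\sum_qF_{pq}z_q$ annihilating it. For an edge $b$, $E_b\subset V_L$ is the space of those $d\in V_L$ whose component in $V_t$ is zero for every $t\not\supset b$. For generic $F$ (in a nonempty Zariski-open set) $\dim E_b=2$, and there exist bases $\mathsf e_b,\mathsf f_b$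 of the $E_b$ ($\mathsf e_{ij}=\mathsf e_{ji}$, $\mathsf f_{ij}=\mathsf f_{ji}$) and nondegenerate diagonal $2\times2$ matrices $A_{ij}$, $i\neq j$, with $\sum_{j\ne i}A_{ij}\begin{pmatrix}\mathsf e_{ij}\\ \mathsf f_{ij}\end{pmatrix}=0$ for every vertex $i$; for fixed $i$ the $A_{ij}$ are unique up to simultaneous left multiplication by a nondegenerate matrix. For each oriented triangle $ijk$ the automorphism of $E_{ij}$ given by $$\begin{pmatrix}\mathsf e_{ij}\\ \mathsf f_{ij}\end{pmatrix}\mapsto A_{ji}^{-1}A_{jk}A_{kj}^{-1}A_{ki}A_{ik}^{-1}A_{ij}\begin{pmatrix}\mathsf e_{ij}\\ \mathsf f_{ij}\end{pmatrix}$$ is then diagonal with mutually inverse eigenvalues; $\omega_{ijk}$ denotes the eigenvalue on $\mathsf e_{ij}$. The numbers $\omega_{ijk}$ form a multiplicative 2-cocycle: $\omega_{-s}=\omega_s^{-1}$ for the oppositely oriented triangle, and $\omega_{ijk}\omega_{ikl}=\omega_{ijl}\omega_{jkl}$. (The cocycle is defined up to the simultaneous replacement $\omega\mapsto\omega^{-1}$ caused by interchanging all $\mathsf e_b$ with all $\mathsf f_b$; "the same $\omega$" means that the choices can be made so that the cocycles coincide.) *)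

theory Defs
  imports "HOL-Analysis.Analysis"
begin

inductive poly_fun :: "('a \<Rightarrow> complex) set \<Rightarrow> ('a \<Rightarrow> complex) \<Rightarrow> bool"
  for C :: "('a \<Rightarrow> complex) set" where
  const: "poly_fun C (\<lambda>x. c)"
| coord: "p \<in> C \<Longrightarrow> poly_fun C p"
| add: "poly_fun C p \<Longrightarrow> poly_fun C q \<Longrightarrow> poly_fun C (\<lambda>x. p x + q x)"
| mult: "poly_fun C p \<Longrightarrow> poly_fun C q \<Longrightarrow> poly_fun C (\<lambda>x. p x * q x)"

definition symmetric_matrices :: "(complex^'n^'n) set" where
  "symmetric_matrices = {F. transpose F = F}"

definition matrix_entries :: "(complex^'n^'m \<Rightarrow> complex) set" where
  "matrix_entries = {(\<lambda>F. F $ p $ q) | p q. True}"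

text \<open>The complement, inside the affine space of symmetric matrices, of the common zero set of \<open>P\<close>.\<close>

definition zariski_open_sym :: "(complex^'n^'n) set \<Rightarrow> bool" where
  "zariski_open_sym U \<longleftrightarrow>
     (\<exists>P. (\<forall>p\<in>P. poly_fun matrix_entries p) \<and>
          U = {F \<in> symmetric_matrices. \<exists>p\<in>P. p F \<noteq> 0})"

text \<open>The five elements of the type \<open>5\<close> are the vertices (the numeral \<open>5\<close> denotes the same
  element as \<open>0\<close>).  A tetrahedron is indexed by the vertex opposite to it.\<close>

type_synonym vertex = 5
type_synonym tetra = vertex

definition tet :: "tetra \<Rightarrow> vertex set" where
  "tet t = - {t}"

lemma bij_betw_tet: "bij_betw tet UNIV {T :: vertex set. card T = 4}"
  unfolding bij_betw_def
proof
  show "inj tet"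
    by (auto simp: tet_def inj_on_def)
  have "T \<in> range tet" if "card T = 4" for T :: "vertex set"
  proof -
    have "card (- T) = 1"
      using that by (simp add: Compl_eq_Diff_UNIV card_Diff_subset)
    then obtain t where "- T = {t}"
      by (auto simp: card_1_singleton_iff)
    then have "T = tet t"
      by (auto simp: tet_def)
    then show ?thesis by simp
  qed
  then show "range tet = {T. card T = 4}"
    by (auto simp: tet_def Compl_eq_Diff_UNIV card_Diff_subset)
qed

text \<open>The variables \<open>x\<^sub>t\<close> and \<open>y\<^sub>t\<close> are indexed by \<open>(t, 1)\<close> and \<open>(t, 2)\<close>.  An element of
  \<open>V\<^sub>t\<close> is given by its coordinates in the basis \<open>\<partial>/\<partial>x\<^sub>t, \<partial>/\<partial>y\<^sub>t, x\<^sub>t, y\<^sub>t\<close>, indexed by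
  \<open>Inl 1, Inl 2, Inr 1, Inr 2\<close>.\<close>

type_synonym var = "tetra \<times> 2"
type_synonym tet_op = "complex^(2 + 2)"
type_synonym pent_op = "complex^(tetra \<times> (2 + 2))"

definition comp_op :: "tetra \<Rightarrow> pent_op \<Rightarrow> tet_op" where
  "comp_op t d = (\<chi> k. d $ (t, k))"

text \<open>The commutator \<open>[v, w]\<close>, see lemma \<open>commutator\<close> below.\<close>

definition sympl :: "tet_op \<Rightarrow> tet_op \<Rightarrow> complex" where
  "sympl v w = (\<Sum>k\<in>UNIV. v $ Inl k * w $ Inr k - v $ Inr k * w $ Inl k)"

definition Sp4 :: "(complex^(2 + 2)^(2 + 2)) set" where
  "Sp4 = {g. \<forall>v w. sympl (g *v v) (g *v w) = sympl v w}"

definition gauge_action :: "(tetra \<Rightarrow> complex^(2 + 2)^(2 + 2)) \<Rightarrow> pent_op \<Rightarrow> pent_op" where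
  "gauge_action g d = (\<chi> i. case i of (t, k) \<Rightarrow> (g t *v comp_op t d) $ k)"

definition gauge_equivalent :: "pent_op set \<Rightarrow> pent_op set \<Rightarrow> bool" where
  "gauge_equivalent L L' \<longleftrightarrow> (\<exists>g. (\<forall>t. g t \<in> Sp4) \<and> gauge_action g ` L = L')"

definition annihilator_op :: "complex^var^var \<Rightarrow> var \<Rightarrow> pent_op" where
  "annihilator_op F p =
     (\<chi> i. case i of
        (t, Inl s) \<Rightarrow> (if p = (t, s) then 1 else 0)
      | (t, Inr s) \<Rightarrow> F $ p $ (t, s))"

definition V_L :: "complex^var^var \<Rightarrow> pent_op set" where
  "V_L F = vec.span (range (annihilator_op F))"

text \<open>The following definitions and lemmas only justify the coordinate description above: \<open>sympl\<close> is
  the commutator, and \<open>V_L F\<close> annihilates the Gaussian weight of \<open>F\<close>.\<close>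

definition partial :: "var \<Rightarrow> (complex^var \<Rightarrow> complex) \<Rightarrow> complex^var \<Rightarrow> complex" where
  "partial p \<phi> z = deriv (\<lambda>s. \<phi> (z + s *s axis p 1)) 0"

definition apply_op :: "pent_op \<Rightarrow> (complex^var \<Rightarrow> complex) \<Rightarrow> complex^var \<Rightarrow> complex" where
  "apply_op d \<phi> z =
     (\<Sum>(t, s)\<in>UNIV. d $ (t, Inl s) * partial (t, s) \<phi> z + d $ (t, Inr s) * (z $ (t, s) * \<phi> z))"

definition weight :: "complex^var^var \<Rightarrow> complex^var \<Rightarrow> complex" where
  "weight F z = exp (- 1 / 2 * (\<Sum>p\<in>UNIV. \<Sum>q\<in>UNIV. F $ p $ q * z $ p * z $ q))"

definition variables :: "(complex^var \<Rightarrow> complex) set" where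
  "variables = range (\<lambda>p z. z $ p)"

lemma poly_fun_has_partial:
  assumes "poly_fun variables \<phi>"
  shows "((\<lambda>s. \<phi> (z + s *s axis p 1)) has_field_derivative partial p \<phi> z) (at 0)"
proof -
  have "\<exists>D. ((\<lambda>s. \<phi> (z + s *s axis p 1)) has_field_derivative D) (at 0)"
    using assms
  proof induction
    case (const c)
    show ?case by (auto intro!: derivative_eq_intros)
  next
    case (coord \<phi>)
    then obtain q where "\<phi> = (\<lambda>z. z $ q)" by (auto simp: variables_def)
    then show ?case by (auto intro!: exI derivative_eq_intros)
  next
    case (add \<phi> \<psi>)
    then obtain D E where
      "((\<lambda>s. \<phi> (z + s *s axis p 1)) has_field_derivative D) (at 0)"
      "((\<lambda>s. \<psi> (z + s *s axis p 1)) has_field_derivative E) (at 0)" by blast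
    then show ?case by (intro exI) (rule DERIV_add)
  next
    case (mult \<phi> \<psi>)
    then obtain D E where
      "((\<lambda>s. \<phi> (z + s *s axis p 1)) has_field_derivative D) (at 0)"
      "((\<lambda>s. \<psi> (z + s *s axis p 1)) has_field_derivative E) (at 0)" by blast
    then show ?case by (intro exI) (rule DERIV_mult)
  qed
  then show ?thesis
    unfolding partial_def by (metis DERIV_imp_deriv)
qed

lemma partial_const: "partial p (\<lambda>z. c) = (\<lambda>z. 0)"
  unfolding partial_def by (rule ext, rule DERIV_imp_deriv) (rule DERIV_const)

lemma partial_coord: "partial p (\<lambda>z. z $ q) = (\<lambda>z. if p = q then 1 else 0)"
  unfolding partial_def
  by (rule ext, rule DERIV_imp_deriv) (auto intro!: derivative_eq_intros simp: axis_def)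

lemma partial_add:
  assumes "poly_fun variables \<phi>" "poly_fun variables \<psi>"
  shows "partial p (\<lambda>z. \<phi> z + \<psi> z) = (\<lambda>z. partial p \<phi> z + partial p \<psi> z)"
proof
  fix z
  show "partial p (\<lambda>z. \<phi> z + \<psi> z) z = partial p \<phi> z + partial p \<psi> z"
    using DERIV_imp_deriv[OF DERIV_add[OF assms[THEN poly_fun_has_partial, of z p]]]
    by (simp add: partial_def[of p "\<lambda>z. \<phi> z + \<psi> z"])
qed

lemma partial_mult:
  assumes "poly_fun variables \<phi>" "poly_fun variables \<psi>"
  shows "partial p (\<lambda>z. \<phi> z * \<psi> z) = (\<lambda>z. partial p \<phi> z * \<psi> z + \<phi> z * partial p \<psi> z)"
proof
  fix z
  show "partial p (\<lambda>z. \<phi> z * \<psi> z) z = partial p \<phi> z * \<psi> z + \<phi> z * partial p \<psi> z"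
    using DERIV_imp_deriv[OF DERIV_mult[OF assms[THEN poly_fun_has_partial, of z p]]]
    by (simp add: partial_def[of p "\<lambda>z. \<phi> z * \<psi> z"] mult.commute)
qed

lemma poly_fun_partial:
  assumes "poly_fun variables \<phi>"
  shows "poly_fun variables (partial p \<phi>)"
  using assms
proof induction
  case (coord \<phi>)
  then obtain q where "\<phi> = (\<lambda>z. z $ q)" by (auto simp: variables_def)
  then show ?case by (simp add: partial_coord poly_fun.const)
qed (auto simp: partial_const partial_add partial_mult intro: poly_fun.intros)

lemma partial_commute:
  assumes "poly_fun variables \<phi>"
  shows "partial p (partial q \<phi>) = partial q (partial p \<phi>)"
  using assms
proof induction
  case (coord \<phi>)
  then obtain r where "\<phi> = (\<lambda>z. z $ r)" by (auto simp: variables_def)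
  then show ?case by (simp add: partial_coord partial_const)
qed (simp_all add: partial_const partial_add partial_mult poly_fun_partial poly_fun.mult
      poly_fun.add algebra_simps)

lemma poly_fun_sum:
  assumes "\<And>i. i \<in> I \<Longrightarrow> poly_fun C (f i)" "finite I"
  shows "poly_fun C (\<lambda>z. \<Sum>i\<in>I. f i z)"
  using assms(2,1) by induction (auto intro: poly_fun.intros)

lemma partial_sum:
  assumes "\<And>i. i \<in> I \<Longrightarrow> poly_fun variables (f i)" "finite I"
  shows "partial p (\<lambda>z. \<Sum>i\<in>I. f i z) = (\<lambda>z. \<Sum>i\<in>I. partial p (f i) z)"
  using assms(2,1) by induction (simp_all add: partial_const partial_add poly_fun_sum)

lemma commutator:
  assumes \<phi>: "poly_fun variables \<phi>"
  shows "apply_op d (apply_op d' \<phi>) z - apply_op d' (apply_op d \<phi>) z =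
         (\<Sum>t\<in>UNIV. sympl (comp_op t d) (comp_op t d')) * \<phi> z"
proof -
  define a where "a = (\<lambda>d p. (d :: pent_op) $ (fst p, Inl (snd p)))"
  define b where "b = (\<lambda>d p. (d :: pent_op) $ (fst p, Inr (snd p)))"
  have coordI: "poly_fun variables (\<lambda>z. z $ q)" for q
    by (intro poly_fun.coord) (simp add: variables_def)
  have op: "apply_op d \<psi> z = (\<Sum>p\<in>UNIV. a d p * partial p \<psi> z + b d p * (z $ p * \<psi> z))" for d \<psi> z
    by (simp add: apply_op_def a_def b_def case_prod_unfold)
  have op': "apply_op d \<psi> = (\<lambda>z. \<Sum>p\<in>UNIV. a d p * partial p \<psi> z + b d p * (z $ p * \<psi> z))" for d \<psi>
    by (rule ext) (rule op)
  have part: "partial p (apply_op d \<phi>) z =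
      (\<Sum>q\<in>UNIV. a d q * partial p (partial q \<phi>) z
        + b d q * (z $ q * partial p \<phi> z)) + b d p * \<phi> z" for d p
  proof -
    have "partial p (apply_op d \<phi>) z =
      (\<Sum>q\<in>UNIV. a d q * partial p (partial q \<phi>) z
        + b d q * (z $ q * partial p \<phi> z) + (if p = q then b d q * \<phi> z else 0))"
      unfolding op'
      by (subst partial_sum)
        (auto simp: partial_add partial_mult partial_const partial_coord coordI poly_fun_partial \<phi>
          poly_fun.const poly_fun.add poly_fun.mult algebra_simps intro!: sum.cong)
    then show ?thesis
      by (simp add: sum.distrib)
  qed
  have two: "apply_op d (apply_op d' \<phi>) z =
      (\<Sum>p\<in>UNIV. \<Sum>q\<in>UNIV. a d p * a d' q * partial p (partial q \<phi>) z
         + a d p * b d' q * z $ q * partial p \<phi> z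
         + b d p * a d' q * z $ p * partial q \<phi> z
         + b d p * b d' q * z $ p * z $ q * \<phi> z)
      + (\<Sum>p\<in>UNIV. a d p * b d' p) * \<phi> z" for d d'
    unfolding op[of d "apply_op d' \<phi>"] part unfolding op
    by (simp add: sum.distrib sum_distrib_left sum_distrib_right algebra_simps)
  have "(\<Sum>p\<in>UNIV. \<Sum>q\<in>UNIV. a d p * a d' q * partial p (partial q \<phi>) z
         + a d p * b d' q * z $ q * partial p \<phi> z
         + b d p * a d' q * z $ p * partial q \<phi> z
         + b d p * b d' q * z $ p * z $ q * \<phi> z) =
        (\<Sum>p\<in>UNIV. \<Sum>q\<in>UNIV. a d' p * a d q * partial p (partial q \<phi>) z
         + a d' p * b d q * z $ q * partial p \<phi> z
         + b d' p * a d q * z $ p * partial q \<phi> z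
         + b d' p * b d q * z $ p * z $ q * \<phi> z)"
    by (subst sum.swap) (intro sum.cong refl, simp add: partial_commute[OF \<phi>] algebra_simps)
  then have "apply_op d (apply_op d' \<phi>) z - apply_op d' (apply_op d \<phi>) z =
      (\<Sum>p\<in>UNIV. a d p * b d' p - b d p * a d' p) * \<phi> z"
    by (simp add: two sum_subtractf algebra_simps)
  also have "(\<Sum>p\<in>UNIV. a d p * b d' p - b d p * a d' p) =
      (\<Sum>t\<in>UNIV. sympl (comp_op t d) (comp_op t d'))"
    unfolding UNIV_Times_UNIV[symmetric, where 'a = tetra and 'b = 2]
    by (simp only: a_def b_def sympl_def comp_op_def sum.cartesian_product case_prod_unfold
        vec_lambda_beta)
  finally show ?thesis .
qed

lemma partial_weight:
  assumes "F \<in> symmetric_matrices"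
  shows "partial p (weight F) z = - (\<Sum>q\<in>UNIV. F $ p $ q * z $ q) * weight F z"
proof -
  have sym: "F $ q $ p = F $ p $ q" for q
  proof -
    have "transpose F $ p $ q = F $ p $ q"
      using assms by (simp add: symmetric_matrices_def)
    then show ?thesis by (simp add: transpose_def)
  qed
  let ?S = "\<Sum>q\<in>UNIV. F $ p $ q * z $ q"
  have quad: "(\<Sum>r\<in>UNIV. \<Sum>q\<in>UNIV. F $ r $ q * (z + s *s axis p 1) $ r * (z + s *s axis p 1) $ q)
      = (\<Sum>r\<in>UNIV. \<Sum>q\<in>UNIV. F $ r $ q * z $ r * z $ q) + 2 * s * ?S + s * s * F $ p $ p" for s
  proof -
    have "(\<Sum>r\<in>UNIV. \<Sum>q\<in>UNIV. F $ r $ q * (z + s *s axis p 1) $ r * (z + s *s axis p 1) $ q) =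
       (\<Sum>r\<in>UNIV. \<Sum>q\<in>UNIV. F $ r $ q * z $ r * z $ q
          + (if q = p then s * (F $ r $ q * z $ r) else 0)
          + (if r = p then s * (F $ r $ q * z $ q) else 0)
          + (if q = p then if r = p then s * s * F $ r $ q else 0 else 0))"
      by (intro sum.cong refl) (simp add: axis_def algebra_simps)
    also have "\<dots> = (\<Sum>r\<in>UNIV. \<Sum>q\<in>UNIV. F $ r $ q * z $ r * z $ q)
        + s * (\<Sum>r\<in>UNIV. F $ r $ p * z $ r) + s * ?S + s * s * F $ p $ p"
    proof -
      have "(\<Sum>r\<in>UNIV. \<Sum>q\<in>UNIV. if r = p then s * (F $ r $ q * z $ q) else 0) = s * ?S"
        by (subst sum.swap) (simp add: sum_distrib_left)
      then show ?thesis
        by (simp add: sum.distrib sum_distrib_left)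
    qed
    also have "(\<Sum>r\<in>UNIV. F $ r $ p * z $ r) = ?S"
      by (rule sum.cong[OF refl], subst sym, rule refl)
    finally show ?thesis by simp
  qed
  have "((\<lambda>s. exp (- 1 / 2 * (c + 2 * s * S + s * s * f))) has_field_derivative
      - S * exp (- 1 / 2 * c)) (at 0)" for c S f :: complex
    by (rule derivative_eq_intros refl | simp)+
  then show ?thesis
    unfolding partial_def weight_def quad by (rule DERIV_imp_deriv)
qed

lemma apply_op_weight:
  assumes F: "F \<in> symmetric_matrices" and d: "d \<in> V_L F"
  shows "apply_op d (weight F) z = 0"
  using d unfolding V_L_def
proof (induction rule: vec.span_induct_alt)
  case base
  show ?case by (simp add: apply_op_def case_prod_unfold)
next
  case (step c x y)
  have lin: "apply_op (c *s x + y) \<phi> z = c * apply_op x \<phi> z + apply_op y \<phi> z" for \<phi>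
    by (simp add: apply_op_def case_prod_unfold sum.distrib sum_distrib_left algebra_simps)
  obtain p where x: "x = annihilator_op F p" using step by blast
  have "apply_op x (weight F) z =
      (\<Sum>q\<in>UNIV. (if p = q then partial q (weight F) z else 0) + F $ p $ q * (z $ q * weight F z))"
    by (auto simp: x apply_op_def annihilator_op_def case_prod_unfold intro!: sum.cong)
  also have "\<dots> = 0"
    by (simp add: sum.distrib partial_weight[OF F] sum_distrib_right mult.assoc)
  finally show ?case using step by (simp add: lin)
qed

definition edge_space :: "complex^var^var \<Rightarrow> vertex set \<Rightarrow> pent_op set" where
  "edge_space F b = {d \<in> V_L F. \<forall>t. \<not> b \<subseteq> tet t \<longrightarrow> comp_op t d = 0}"

definition edge_bases ::
    "complex^var^var \<Rightarrow> (vertex set \<Rightarrow> pent_op) \<Rightarrow> (vertex set \<Rightarrow> pent_op) \<Rightarrow> bool" where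
  "edge_bases F e f \<longleftrightarrow>
     (\<forall>b. card b = 2 \<longrightarrow>
        e b \<noteq> f b \<and> vec.independent {e b, f b} \<and> vec.span {e b, f b} = edge_space F b)"

definition edge_col ::
    "(vertex set \<Rightarrow> pent_op) \<Rightarrow> (vertex set \<Rightarrow> pent_op) \<Rightarrow> vertex \<Rightarrow> vertex \<Rightarrow> pent_op^2" where
  "edge_col e f i j = vector [e {i, j}, f {i, j}]"

definition mat_col :: "complex^2^2 \<Rightarrow> pent_op^2 \<Rightarrow> pent_op^2" where
  "mat_col M w = (\<chi> r. \<Sum>s\<in>UNIV. M $ r $ s *s w $ s)"

definition diagonal_matrix :: "complex^'n^'n \<Rightarrow> bool" where
  "diagonal_matrix M \<longleftrightarrow> (\<forall>r s. r \<noteq> s \<longrightarrow> M $ r $ s = 0)"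

definition vertex_relations ::
    "(vertex set \<Rightarrow> pent_op) \<Rightarrow> (vertex set \<Rightarrow> pent_op) \<Rightarrow> (vertex \<Rightarrow> vertex \<Rightarrow> complex^2^2) \<Rightarrow> bool"
  where
  "vertex_relations e f A \<longleftrightarrow>
     (\<forall>i j. i \<noteq> j \<longrightarrow> diagonal_matrix (A i j) \<and> invertible (A i j)) \<and>
     (\<forall>i. (\<Sum>j\<in>- {i}. mat_col (A i j) (edge_col e f i j)) = 0)"

definition holonomy ::
    "(vertex \<Rightarrow> vertex \<Rightarrow> complex^2^2) \<Rightarrow> vertex \<Rightarrow> vertex \<Rightarrow> vertex \<Rightarrow> complex^2^2" where
  "holonomy A i j k =
     matrix_inv (A j i) ** A j k ** matrix_inv (A k j) ** A k i ** matrix_inv (A i k) ** A i j"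

text \<open>\<open>has_cocycle F \<omega>\<close>: for some admissible choice of bases and matrices, \<open>\<omega> i j k\<close> is the eigenvalue
  on \<open>e {i, j}\<close> (first entry of the column) for every oriented triangle; the values of \<open>\<omega>\<close> on
  degenerate triples are irrelevant.  As the choice is existentially quantified, \<open>\<omega>\<close> and its inverse
  (exchange of all \<open>e b\<close> with \<open>f b\<close>) are both cocycles of \<open>F\<close>.\<close>

definition has_cocycle :: "complex^var^var \<Rightarrow> (vertex \<Rightarrow> vertex \<Rightarrow> vertex \<Rightarrow> complex) \<Rightarrow> bool" where
  "has_cocycle F \<omega> \<longleftrightarrow>
     (\<exists>e f A. edge_bases F e f \<and> vertex_relations e f A \<and>
        (\<forall>i j k. i \<noteq> j \<and> j \<noteq> k \<and> i \<noteq> k \<longrightarrow>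
           mat_col (holonomy A i j k) (edge_col e f i j) $ 1 = \<omega> i j k *s e {i, j}))"

end

theory Submission
  imports Defs
begin

text \<open>Since the \<open>A\<^sub>i\<^sub>j\<close> are diagonal, the vertex relations split into relations \<open>\<Sum>\<^sub>j a\<^sub>i\<^sub>j e\<^sub>i\<^sub>j = 0\<close> and
  \<open>\<Sum>\<^sub>j c\<^sub>i\<^sub>j f\<^sub>i\<^sub>j = 0\<close>.  For generic \<open>F\<close> the components in \<open>V\<^sub>t\<close> of the vectors of two opposite edges of
  \<open>t\<close> form a basis of \<open>V\<^sub>t\<close>, and the vertex relations express the components of the other four edges in
  this basis by coefficients depending only on \<open>a\<close> and \<open>c\<close>.  Opposite edges are orthogonal in \<open>V\<^sub>t\<close>,
  because \<open>t\<close> is the only tetrahedron containing both of them and \<open>V\<^sub>L\<close> is isotropic.  This determines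
  the symplectic form on \<open>V\<^sub>t\<close> up to a factor by \<open>a\<close> and \<open>c\<close>, and shows that the holonomies of \<open>a\<close> and
  \<open>c\<close> are mutually inverse.  Hence equal cocycles allow us to rescale the edge vectors so that \<open>a = a'\<close>
  and \<open>c = c'\<close>.  Mapping bases of the \<open>V\<^sub>t\<close> to each other then gives symplectic similitudes carrying
  every edge vector to its counterpart.  Adjacent edges have two tetrahedra in common, where their
  products are opposite, so all similitude factors agree, and one rescaling of the \<open>e'\<^sub>b\<close> makes
  them equal to 1.

  Two genericity conditions suffice: the independence of opposite edges in \<open>V\<^sub>t\<close>, and the absence of
  nonzero flows with values in the edge spaces, which excludes the degenerate case \<open>\<omega> = -1\<close>.\<close>

section \<open>Generic symmetric matrices\<close>

lemma poly_fun_prod: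
  assumes "\<And>i. i \<in> I \<Longrightarrow> poly_fun C (f i)" "finite I"
  shows "poly_fun C (\<lambda>z. \<Prod>i\<in>I. f i z)"
  using assms(2,1) by induction (auto intro: poly_fun.intros)

lemma poly_fun_diff:
  assumes "poly_fun C p" "poly_fun C q"
  shows "poly_fun C (\<lambda>x. p x - q x)"
  using poly_fun.add[OF assms(1) poly_fun.mult[OF poly_fun.const assms(2), of "-1"]] by simp

lemma poly_fun_if:
  assumes "b \<Longrightarrow> poly_fun C p" "\<not> b \<Longrightarrow> poly_fun C q"
  shows "poly_fun C (\<lambda>x. if b then p x else q x)"
  using assms by (cases b) simp_all

lemma poly_fun_det:
  fixes M :: "'a \<Rightarrow> complex^'n^'n"
  assumes "\<And>i j. poly_fun C (\<lambda>x. M x $ i $ j)"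
  shows "poly_fun C (\<lambda>x. det (M x))"
  unfolding det_def
  by (intro poly_fun_sum poly_fun.mult poly_fun_prod assms poly_fun.const finite_permutations) auto

lemma poly_fun_matrix_entry: "poly_fun matrix_entries (\<lambda>F. F $ p $ q)"
  by (rule poly_fun.coord) (auto simp: matrix_entries_def)

text \<open>A single witness polynomial is kept, so that conjunctions of conditions become products
  of polynomials and the final open set is principal.\<close>

definition generic :: "(complex^'n^'n \<Rightarrow> bool) \<Rightarrow> bool" where
  "generic Q \<longleftrightarrow> (\<exists>p. poly_fun matrix_entries p \<and> (\<exists>F\<in>symmetric_matrices. p F \<noteq> 0) \<and>
     (\<forall>F\<in>symmetric_matrices. p F \<noteq> 0 \<longrightarrow> Q F))"

lemma poly_fun_on_line:
  fixes G H :: "complex^'n^'n"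
  assumes "poly_fun matrix_entries p"
  shows "\<exists>q. \<forall>s. p (\<chi> i j. G $ i $ j + s * H $ i $ j) = poly q s"
  using assms
proof induction
  case (const c)
  then show ?case by (intro exI[of _ "[:c:]"]) simp
next
  case (coord p)
  then obtain i j where "p = (\<lambda>F. F $ i $ j)" by (auto simp: matrix_entries_def)
  then show ?case by (intro exI[of _ "[:G $ i $ j, H $ i $ j:]"]) simp
next
  case (add p q)
  then show ?case by (metis poly_add)
next
  case (mult p q)
  then show ?case by (metis poly_mult)
qed

text \<open>Irreducibility of the space of symmetric matrices: on the line through two points, two nonzero
  polynomials have a nonzero product.\<close>

lemma generic_conj:
  fixes Q R :: "complex^'n^'n \<Rightarrow> bool"
  assumes "generic Q" "generic R"
  shows "generic (\<lambda>F. Q F \<and> R F)"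
proof -
  obtain p F where p: "poly_fun matrix_entries p" "F \<in> symmetric_matrices" "p F \<noteq> 0"
    "\<And>F. F \<in> symmetric_matrices \<Longrightarrow> p F \<noteq> 0 \<Longrightarrow> Q F"
    using assms(1) unfolding generic_def by blast
  obtain q G where q: "poly_fun matrix_entries q" "G \<in> symmetric_matrices" "q G \<noteq> 0"
    "\<And>F. F \<in> symmetric_matrices \<Longrightarrow> q F \<noteq> 0 \<Longrightarrow> R F"
    using assms(2) unfolding generic_def by blast
  define l where "l = (\<lambda>s::complex. \<chi> i j. F $ i $ j + s * (G - F) $ i $ j)"
  obtain a where a: "\<And>s. p (l s) = poly a s"
    using poly_fun_on_line[OF p(1)] unfolding l_def by meson
  obtain b where b: "\<And>s. q (l s) = poly b s"
    using poly_fun_on_line[OF q(1)] unfolding l_def by meson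
  have "l 0 = F" "l 1 = G" by (simp_all add: l_def vec_eq_iff)
  then have "a \<noteq> 0" "b \<noteq> 0" using p(3) q(3) a[of 0] b[of 1] by auto
  then have "a * b \<noteq> 0" by simp
  then obtain s where s: "poly (a * b) s \<noteq> 0" using poly_all_0_iff_0 by blast
  have "l s \<in> symmetric_matrices"
    using p(2) q(2) by (simp add: l_def symmetric_matrices_def transpose_def vec_eq_iff)
  moreover have "p (l s) * q (l s) \<noteq> 0" using s by (simp add: a b)
  ultimately show ?thesis
    unfolding generic_def
    by (intro exI[of _ "\<lambda>F. p F * q F"]) (use p q in \<open>auto intro: poly_fun.mult\<close>)
qed

lemma generic_mono:
  assumes "generic Q" "\<And>F. F \<in> symmetric_matrices \<Longrightarrow> Q F \<Longrightarrow> R F"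
  shows "generic R"
  using assms unfolding generic_def by blast

lemma generic_True: "generic (\<lambda>F :: complex^'n^'n. True)"
proof -
  have "(0 :: complex^'n^'n) \<in> symmetric_matrices"
    by (simp add: symmetric_matrices_def transpose_def vec_eq_iff)
  then show ?thesis
    unfolding generic_def by (intro exI[of _ "\<lambda>_. 1"]) (auto intro: poly_fun.const)
qed

lemma generic_Ball:
  assumes "finite I" "\<And>i. i \<in> I \<Longrightarrow> generic (Q i)"
  shows "generic (\<lambda>F. \<forall>i\<in>I. Q i F)"
  using assms by induction (auto simp: generic_True intro: generic_conj)

text \<open>If \<open>N\<close> is a left inverse of the matrix \<open>M F\<^sub>0\<close> of the system at \<open>F\<^sub>0\<close>, then \<open>M F\<close> is injective
  as soon as \<open>det (N ** M F) \<noteq> 0\<close>.\<close>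

lemma generic_injective:
  fixes L :: "complex^'k^'k \<Rightarrow> complex^'n \<Rightarrow> complex^'m"
  assumes lin: "\<And>F. Vector_Spaces.linear (*s) (*s) (L F)"
    and poly: "\<And>n m. poly_fun matrix_entries (\<lambda>F. L F (axis n 1) $ m)"
    and F0: "F0 \<in> symmetric_matrices" "\<And>u. L F0 u = 0 \<Longrightarrow> u = 0"
  shows "generic (\<lambda>F. \<forall>u. L F u = 0 \<longrightarrow> u = 0)"
proof -
  have L: "matrix (L F) *v u = L F u" for F u
    by (rule matrix_works[OF lin])
  obtain N where N: "N ** matrix (L F0) = mat 1"
    using F0(2) L by (metis matrix_left_invertible_ker)
  define p where "p = (\<lambda>F. det (N ** matrix (L F)))"
  have "poly_fun matrix_entries p"
    unfolding p_def
    by (intro poly_fun_det)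
      (auto simp: matrix_matrix_mult_def matrix_def intro!: poly_fun_sum poly_fun.mult poly_fun.const poly)
  moreover have "p F0 \<noteq> 0" by (simp add: p_def N)
  moreover have "u = 0" if "p F \<noteq> 0" "L F u = 0" for F u
  proof -
    have "invertible (N ** matrix (L F))"
      using that(1) by (simp add: p_def invertible_det_nz)
    then have "inj ((*v) (N ** matrix (L F)))" by (simp add: inj_matrix_vector_mult)
    moreover have "(N ** matrix (L F)) *v u = (N ** matrix (L F)) *v 0"
      using that(2) by (simp add: matrix_vector_mul_assoc[symmetric] L)
    ultimately show ?thesis by (rule injD)
  qed
  ultimately show ?thesis using F0(1) unfolding generic_def by blast
qed

section \<open>The Lagrangian subspace and its edge spaces\<close>

text \<open>\<open>V_L F\<close> is the graph of the linear map given by \<open>F\<close>;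
  \<open>v\<close> holds the coefficients at the derivatives. This parametrization turns conditions
  on edge spaces into linear systems whose entries are polynomial in \<open>F\<close>.\<close>

definition graph_op :: "complex^var^var \<Rightarrow> complex^var \<Rightarrow> pent_op" where
  "graph_op F v =
     (\<chi> i. case i of (t, Inl s) \<Rightarrow> v $ (t, s) | (t, Inr s) \<Rightarrow> (\<Sum>p\<in>UNIV. v $ p * F $ p $ (t, s)))"

lemma graph_op_add: "graph_op F (v + w) = graph_op F v + graph_op F w"
  by (auto simp: graph_op_def vec_eq_iff sum.distrib algebra_simps split: sum.split)

lemma graph_op_scale: "graph_op F (c *s v) = c *s graph_op F v"
  by (auto simp: graph_op_def vec_eq_iff sum_distrib_left algebra_simps split: sum.split)

lemma linear_graph_op: "Vector_Spaces.linear (*s) (*s) (graph_op F)"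
  by (simp add: Vector_Spaces.linear_iff graph_op_add graph_op_scale vec.vector_space_axioms)

lemma graph_op_axis: "graph_op F (axis p 1) = annihilator_op F p"
  by (auto simp: graph_op_def annihilator_op_def vec_eq_iff axis_def if_distrib if_distribR cong: if_cong split: sum.split)

lemma V_L_eq_range: "V_L F = range (graph_op F)"
proof
  have "vec.subspace (range (graph_op F))"
    by (intro vec.linear_subspace_image linear_graph_op vec.subspace_UNIV)
  then show "V_L F \<subseteq> range (graph_op F)"
    unfolding V_L_def by (intro vec.span_minimal) (auto simp: graph_op_axis[symmetric])
next
  have "graph_op F v = (\<Sum>p\<in>UNIV. v $ p *s annihilator_op F p)" for v
    by (auto simp: graph_op_def annihilator_op_def vec_eq_iff if_distrib cong: if_cong split: sum.split)
  then show "range (graph_op F) \<subseteq> V_L F"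
    unfolding V_L_def by (auto intro!: vec.span_sum vec.span_scale intro: vec.span_base)
qed

lemma subspace_V_L: "vec.subspace (V_L F)"
  by (simp add: V_L_def vec.subspace_span)

section \<open>Components in the tetrahedra and the symplectic form\<close>

lemma comp_op_add: "comp_op t (x + y) = comp_op t x + comp_op t y"
  and comp_op_scale: "comp_op t (c *s x) = c *s comp_op t x"
  and comp_op_zero: "comp_op t 0 = 0"
  by (simp_all add: comp_op_def vec_eq_iff)

lemma comp_op_diff: "comp_op t (x - y) = comp_op t x - comp_op t y"
  by (simp add: comp_op_def vec_eq_iff)

lemma pent_op_eqI: "(\<And>t. comp_op t x = comp_op t y) \<Longrightarrow> x = y"
  by (auto simp: comp_op_def vec_eq_iff)

lemma sympl_add_left: "sympl (x + y) z = sympl x z + sympl y z"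
  and sympl_add_right: "sympl z (x + y) = sympl z x + sympl z y"
  and sympl_scale_left: "sympl (c *s x) z = c * sympl x z"
  and sympl_scale_right: "sympl z (c *s x) = c * sympl z x"
  and sympl_self: "sympl x x = 0"
  and sympl_zero_left: "sympl 0 x = 0"
  and sympl_zero_right: "sympl x 0 = 0"
  by (simp_all add: sympl_def sum_2 algebra_simps)

lemma sympl_commute: "sympl x y = - sympl y x"
  by (simp add: sympl_def sum_2 algebra_simps)

lemma sympl_nondegenerate:
  assumes "\<And>w. sympl v w = 0"
  shows "v = 0"
proof -
  have "v $ Inl k = 0" for k
    using assms[of "axis (Inr k) 1"] by (simp add: sympl_def axis_def if_distrib if_distribR cong: if_cong)
  moreover have "v $ Inr k = 0" for k
    using assms[of "axis (Inl k) 1"]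
    by (simp add: sympl_def axis_def if_distrib if_distribR sum_negf cong: if_cong)
  ultimately show ?thesis
    unfolding vec_eq_iff using sum.exhaust by (metis zero_index)
qed

lemma sum_UNIV_prod: "(\<Sum>p\<in>UNIV. f p) = (\<Sum>t\<in>UNIV. \<Sum>s\<in>UNIV. f (t, s))"
  unfolding sum.cartesian_product UNIV_Times_UNIV by simp

text \<open>For two graph vectors the total form is a difference of two double sums, which agree
  after swapping indices because \<open>F\<close> is symmetric.\<close>

lemma V_L_isotropic:
  assumes F: "F \<in> symmetric_matrices" and "d \<in> V_L F" "d' \<in> V_L F"
  shows "(\<Sum>t\<in>UNIV. sympl (comp_op t d) (comp_op t d')) = 0"
proof -
  obtain v v' where d: "d = graph_op F v" "d' = graph_op F v'"
    using assms(2,3) by (auto simp: V_L_eq_range)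
  have sym: "F $ p $ q = F $ q $ p" for p q
    using F unfolding symmetric_matrices_def transpose_def
    by (metis (mono_tags, lifting) mem_Collect_eq vec_lambda_beta)
  have "(\<Sum>t\<in>UNIV. sympl (comp_op t d) (comp_op t d')) =
     (\<Sum>q\<in>UNIV. v $ q * (\<Sum>p\<in>UNIV. v' $ p * F $ p $ q) - (\<Sum>p\<in>UNIV. v $ p * F $ p $ q) * v' $ q)"
    by (subst (3) sum_UNIV_prod) (simp add: sympl_def comp_op_def d graph_op_def)
  also have "\<dots> = (\<Sum>q\<in>UNIV. \<Sum>p\<in>UNIV. v $ q * v' $ p * F $ p $ q)
                 - (\<Sum>q\<in>UNIV. \<Sum>p\<in>UNIV. v $ p * v' $ q * F $ p $ q)"
    by (simp add: sum_subtractf sum_distrib_left sum_distrib_right mult_ac)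
  also have "(\<Sum>q\<in>UNIV. \<Sum>p\<in>UNIV. v $ p * v' $ q * F $ p $ q) =
      (\<Sum>q\<in>UNIV. \<Sum>p\<in>UNIV. v $ q * v' $ p * F $ p $ q)"
    by (subst sum.swap) (intro sum.cong refl, metis sym)
  finally show ?thesis by simp
qed

lemma edge_space_iff: "d \<in> edge_space F b \<longleftrightarrow> d \<in> V_L F \<and> (\<forall>t\<in>b. comp_op t d = 0)"
  by (auto simp: edge_space_def tet_def)

lemma vertex_UNIV:
  assumes "distinct [i, j, k, l, t :: vertex]"
  shows "UNIV = {i, j, k, l, t}"
  by (rule card_subset_eq[symmetric]) (use assms in auto)

lemma sum_vertex:
  assumes "distinct [i, j, k, l, t :: vertex]"
  shows "(\<Sum>s\<in>UNIV. f s) = f i + f j + f k + f l + f t"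
  by (subst vertex_UNIV[OF assms]) (use assms in \<open>simp add: algebra_simps\<close>)

lemma sum_var: "(\<Sum>p\<in>UNIV. f p) = (\<Sum>s\<in>UNIV. f (s, 1) + f (s, 2 :: 2))"
  by (simp add: sum_UNIV_prod sum_2)

text \<open>One implication encodes two facts: the images of the two edge spaces in
  \<open>V\<^sub>t\<close> meet only in 0, and (taking one vector to be 0) the component map is
  injective on each edge space.\<close>

definition opposite_edges_independent :: "complex^var^var \<Rightarrow> bool" where
  "opposite_edges_independent F \<longleftrightarrow>
     (\<forall>i j k l t. distinct [i, j, k, l, t] \<longrightarrow>
        (\<forall>x\<in>edge_space F {i, j}. \<forall>y\<in>edge_space F {k, l}.
           comp_op t x = comp_op t y \<longrightarrow> x = 0 \<and> y = 0))"

text \<open>The value \<open>x i j\<close> is carried from \<open>i\<close> to \<open>j\<close> and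
  conserved at every vertex. Vertex relations that could be scaled to be antisymmetric in
  \<open>i\<close> and \<open>j\<close> would produce such a flow.\<close>

definition no_nonzero_flow :: "complex^var^var \<Rightarrow> bool" where
  "no_nonzero_flow F \<longleftrightarrow>
     (\<forall>x :: vertex \<Rightarrow> vertex \<Rightarrow> pent_op.
        (\<forall>i j. x i j \<in> edge_space F {i, j}) \<and> (\<forall>i j. x j i = - x i j) \<and> (\<forall>i. (\<Sum>j\<in>UNIV. x i j) = 0) \<longrightarrow>
        (\<forall>i j. x i j = 0))"

section \<open>Genericity of the two conditions\<close>

lemma graph_op_zero: "graph_op F 0 = 0"
  by (simp add: graph_op_def vec_eq_iff split: sum.split)

lemma poly_fun_graph_op: "poly_fun matrix_entries (\<lambda>F. graph_op F v $ m)"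
proof (cases m)
  case (Pair t k)
  then show ?thesis
    by (cases k) (auto simp: graph_op_def intro!: poly_fun.const poly_fun_sum poly_fun.mult poly_fun_matrix_entry)
qed

lemma generic_opposite_edges_independent_fixed:
  assumes d: "distinct [i, j, k, l, t]"
  shows "generic (\<lambda>F. \<forall>x\<in>edge_space F {i, j}. \<forall>y\<in>edge_space F {k, l}.
           comp_op t x = comp_op t y \<longrightarrow> x = 0 \<and> y = 0)"
proof -
  \<comment> \<open>The unknown \<open>u\<close> holds the coordinates of \<open>x\<close> and
    \<open>y\<close>. The rows at \<open>i, j\<close> contain only \<open>x\<close>, those at
    \<open>k, l\<close> only \<open>y\<close>, and those at \<open>t\<close> the difference, so the
    kernel of \<open>L F\<close> is the set of pairs violating independence, together with
    0.\<close>
  define L :: "complex^var^var \<Rightarrow> complex^(var + var) \<Rightarrow> pent_op" where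
    "L = (\<lambda>F u. \<chi> m. (if fst m \<in> {k, l} then 0 else graph_op F (\<chi> p. u $ Inl p) $ m)
                    - (if fst m \<in> {i, j} then 0 else graph_op F (\<chi> p. u $ Inr p) $ m))"
  \<comment> \<open>Identity blocks couple \<open>i\<close> with \<open>k\<close>, \<open>j\<close>
    with \<open>l\<close> and \<open>i\<close> with \<open>t\<close>. They leave the component of
    \<open>w\<close> at \<open>t\<close> undetermined; the one extra entry between
    \<open>(k, 1)\<close> and \<open>(t, 2)\<close> forces it to vanish.\<close>
  define F0 :: "complex^var^var" where
    "F0 = (\<chi> p q.
       if {fst p, fst q} = {i, k} \<or> {fst p, fst q} = {j, l} \<or> {fst p, fst q} = {i, t}
       then (if snd p = snd q then 1 else 0)
       else if {p, q} = {(k, 1), (t, 2)} then 1 else 0)"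
  have ne: "i \<noteq> j" "i \<noteq> k" "i \<noteq> l" "i \<noteq> t" "j \<noteq> k" "j \<noteq> l" "j \<noteq> t" "k \<noteq> l" "k \<noteq> t" "l \<noteq> t"
    using d by auto
  note ne = ne ne[symmetric]
  have proj: "(\<chi> p. (u + v) $ Inl p) = (\<chi> p. u $ Inl p) + (\<chi> p. v $ Inl p)"
    "(\<chi> p. (u + v) $ Inr p) = (\<chi> p. u $ Inr p) + (\<chi> p. v $ Inr p)"
    "(\<chi> p. (c *s u) $ Inl p) = c *s (\<chi> p. u $ Inl p)"
    "(\<chi> p. (c *s u) $ Inr p) = c *s (\<chi> p. u $ Inr p)" for u v :: "complex^(var + var)" and c
    by (simp_all add: vec_eq_iff)
  have "generic (\<lambda>F. \<forall>u. L F u = 0 \<longrightarrow> u = 0)"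
  proof (rule generic_injective[where ?F0.0 = F0])
    show "Vector_Spaces.linear (*s) (*s) (L F)" for F
      by (auto simp: Vector_Spaces.linear_iff vec.vector_space_axioms L_def proj graph_op_add
          graph_op_scale vec_eq_iff algebra_simps simp del: vector_add_component vector_smult_component)
        (auto simp: algebra_simps)
    show "poly_fun matrix_entries (\<lambda>F. L F (axis n 1) $ m)" for n m
      by (auto simp: L_def intro!: poly_fun_diff poly_fun_if poly_fun.const poly_fun_graph_op)
    show "F0 \<in> symmetric_matrices"
      by (simp add: symmetric_matrices_def transpose_def vec_eq_iff F0_def insert_commute eq_commute)
  next
    fix u assume u: "L F0 u = 0"
    define v where "v = (\<chi> p. u $ Inl p)"
    define w where "w = (\<chi> p. u $ Inr p)"
    have L0: "L F0 u $ (s, r) = 0" for s r using u by simp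
    have eqs: "graph_op F0 v $ (i, r) = 0" "graph_op F0 v $ (j, r) = 0"
      "graph_op F0 w $ (k, r) = 0" "graph_op F0 w $ (l, r) = 0"
      "graph_op F0 v $ (t, r) = graph_op F0 w $ (t, r)" for r
      using L0[of i r] L0[of j r] L0[of k r] L0[of l r] L0[of t r] ne
      by (simp_all add: L_def v_def w_def)
    note eval = graph_op_def F0_def sum_var sum_vertex[OF d] doubleton_eq_iff
    have v0: "v $ (i, a) = 0" "v $ (j, a) = 0" "w $ (k, a) = 0" "w $ (l, a) = 0"
      "v $ (t, a) = w $ (t, a)" for a
      using eqs[of "Inl a"] by (simp_all add: graph_op_def)
    have vk: "v $ (k, a) = - w $ (t, a)" "v $ (l, a) = 0" "w $ (j, a) = 0" for a
      using eqs[of "Inr a"] exhaust_2[of a] ne by (auto simp: eval v0 eq_neg_iff_add_eq_0)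
    have wi: "w $ (i, 1) = - w $ (t, 2)" "w $ (i, 2) = 0"
      using eqs(3)[of "Inr 1"] eqs(3)[of "Inr 2"] ne by (auto simp: eval v0 eq_neg_iff_add_eq_0)
    have wt: "w $ (t, 1) = 0" "w $ (t, 2) = 0"
      using eqs(5)[of "Inr 1"] eqs(5)[of "Inr 2"] ne by (auto simp: eval v0 vk wi)
    have "v $ (s, a) = 0 \<and> w $ (s, a) = 0" for s a
      using vertex_UNIV[OF d] exhaust_2[of a] v0[of a] vk[of a] wi wt by auto
    then have "u $ m = 0" for m by (cases m) (auto simp: v_def w_def)
    then show "u = 0" by (simp add: vec_eq_iff)
  qed
  then show ?thesis
  proof (rule generic_mono, intro ballI impI)
    fix F x y
    assume inj: "\<forall>u. L F u = 0 \<longrightarrow> u = 0"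
      and x: "x \<in> edge_space F {i, j}" and y: "y \<in> edge_space F {k, l}"
      and eq: "comp_op t x = comp_op t y"
    obtain v w where vw: "x = graph_op F v" "y = graph_op F w"
      using x y by (auto simp: edge_space_iff V_L_eq_range)
    define u :: "complex^(var + var)" where
      "u = (\<chi> m. case m of Inl p \<Rightarrow> v $ p | Inr p \<Rightarrow> w $ p)"
    have x0: "graph_op F v $ (s, r) = 0" if "s \<in> {i, j}" for s r
      using x that by (auto simp: vw edge_space_iff comp_op_def vec_eq_iff)
    have y0: "graph_op F w $ (s, r) = 0" if "s \<in> {k, l}" for s r
      using y that by (auto simp: vw edge_space_iff comp_op_def vec_eq_iff)
    have xy: "graph_op F v $ (t, r) = graph_op F w $ (t, r)" for r
      using eq by (simp add: vw comp_op_def vec_eq_iff)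
    have Lu: "L F u $ (s, r) = (if s \<in> {k, l} then 0 else graph_op F v $ (s, r))
                    - (if s \<in> {i, j} then 0 else graph_op F w $ (s, r))" for s r
      by (simp add: L_def u_def)
    have "L F u $ (s, r) = 0" for s r
    proof -
      consider "s \<in> {i, j}" | "s \<in> {k, l}" | "s = t"
        using vertex_UNIV[OF d] by blast
      then show ?thesis
        by cases (use ne in \<open>simp_all only: Lu x0 y0 xy, auto simp: x0 y0\<close>)
    qed
    then have "u = 0" using inj by (simp add: vec_eq_iff)
    then have "u $ Inl p = 0" "u $ Inr p = 0" for p by simp_all
    then have "v = 0" "w = 0" by (simp_all add: u_def vec_eq_iff)
    then show "x = 0 \<and> y = 0" by (simp add: vw graph_op_zero)
  qed
qed

lemma generic_opposite_edges_independent: "generic opposite_edges_independent"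
proof -
  define C :: "vertex \<times> vertex \<times> vertex \<times> vertex \<times> vertex \<Rightarrow> complex^var^var \<Rightarrow> bool" where
    "C = (\<lambda>(i, j, k, l, t) F. \<forall>x\<in>edge_space F {i, j}. \<forall>y\<in>edge_space F {k, l}.
            comp_op t x = comp_op t y \<longrightarrow> x = 0 \<and> y = 0)"
  have *: "generic (C (i, j, k, l, t))" if "distinct [i, j, k, l, t]" for i j k l t
    using generic_opposite_edges_independent_fixed[OF that] by (simp only: C_def prod.case)
  have "generic (\<lambda>F. \<forall>q\<in>{(i, j, k, l, t). distinct [i, j, k, l, t]}. C q F)"
  proof (rule generic_Ball)
    fix q assume "q \<in> {(i, j, k, l, t). distinct [i, j, k, l, t :: vertex]}"
    then show "generic (C q)" using * by (cases q) (simp only: mem_Collect_eq prod.case)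
  qed (rule finite)
  then show ?thesis
  proof (rule generic_mono)
    fix F assume *: "\<forall>q\<in>{(i, j, k, l, t). distinct [i, j, k, l, t]}. C q F"
    have "C (i, j, k, l, t) F" if "distinct [i, j, k, l, t]" for i j k l t
      using * that by blast
    then show "opposite_edges_independent F"
      unfolding opposite_edges_independent_def C_def prod.case by blast
  qed
qed

text \<open>At the adjacency matrix of the 5-cycle, tensored with the identity of size 2, a flow reduces to one
  value \<open>y k\<close> per tetrahedron, with \<open>y (k + 2) = - y k\<close>; as 5 is odd, \<open>y = 0\<close>.\<close>

lemma flow_of_five_cycle_eq_0:
  fixes X :: "5 \<Rightarrow> 5 \<Rightarrow> 5 \<Rightarrow> complex"
  assumes anti: "\<And>k i j. X k j i = - X k i j" and zero: "\<And>i j. X i i j = 0"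
    and div: "\<And>k i. (\<Sum>j\<in>UNIV. X k i j) = 0"
    and eq: "\<And>i j. i \<noteq> j \<Longrightarrow> X (i + 1) i j + X (i + 4) i j = 0"
  shows "X k i j = 0"
proof -
  have zero': "X j i j = 0" for i j using anti[of j j i] zero by simp
  have d: "distinct [k, k + 1, k + 2, k + 3, k + 4]" for k :: 5 by simp
  have five: "k + 5 = k" "k + 6 = k + 1" "k + 7 = k + 2" "k + 8 = k + 3" for k :: 5
    by simp_all
  \<comment> \<open>For neighbouring vertices of the 5-cycle, one of the two terms of
    \<open>eq\<close> belongs to a tetrahedron not containing the edge.\<close>
  have e43: "X k (k + 4) (k + 3) = 0" for k
    using eq[of "k + 4" "k + 3"] by (simp add: zero' add.assoc five)
  have e12: "X k (k + 1) (k + 2) = 0" for k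
    using eq[of "k + 1" "k + 2"] by (simp add: zero' add.assoc five)
  \<comment> \<open>The edges of tetrahedron \<open>k\<close> not yet known to carry zero form the
    4-cycle \<open>k + 4, k + 1, k + 3, k + 2\<close>. A conserved flow on a cycle circulates with
    one constant value.\<close>
  define y where "y = (\<lambda>k. X k (k + 4) (k + 1))"
  have self: "X k i i = 0" for k i using anti[of k i i] by simp
  have s4: "X k (k + 4) (k + 2) = - y k" for k
    using div[of k "k + 4"] unfolding sum_vertex[OF d[of k]]
    by (simp add: zero' self e43 y_def eq_neg_iff_add_eq_0 add.commute)
  have s1: "X k (k + 1) (k + 3) = y k" for k
  proof -
    have "X k (k + 1) (k + 3) + X k (k + 1) (k + 4) = 0"
      using div[of k "k + 1"] unfolding sum_vertex[OF d[of k]] by (simp add: zero' self e12)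
    then show ?thesis using anti[of k "k + 1" "k + 4"] by (simp add: y_def)
  qed
  have s3: "X k (k + 3) (k + 2) = y k" for k
  proof -
    have "X k (k + 3) (k + 1) + X k (k + 3) (k + 2) = 0"
      using div[of k "k + 3"] anti[of k "k + 3" "k + 4"] unfolding sum_vertex[OF d[of k]]
      by (simp add: zero' self e43)
    then show ?thesis using anti[of k "k + 3" "k + 1"] s1[of k] by simp
  qed
  have "y (k + 2) = - y k" for k
    using eq[of "k + 1" "k + 3"] s1[of k] anti[of "k + 2" "k + 1" "k + 3"] 
    by (simp add: y_def add.assoc five eq_neg_iff_add_eq_0)
  from this[of k] this[of "k + 2"] this[of "k + 4"] this[of "k + 1"] this[of "k + 3"]
  have y: "y k = 0" by (simp add: add.assoc five)
  have z: "X k (k + 4) (k + 3) = 0" "X k (k + 1) (k + 2) = 0" "X k (k + 4) (k + 2) = 0"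
    "X k (k + 1) (k + 3) = 0" "X k (k + 3) (k + 2) = 0" "X k (k + 4) (k + 1) = 0"
    using e43[of k] e12[of k] s4[of k] s1[of k] s3[of k] y by (simp_all add: y_def)
  have rev: "X k b a = 0" if "X k a b = 0" for a b
    using anti[of k b a] that by simp
  have "\<forall>a\<in>{k, k + 1, k + 2, k + 3, k + 4}. \<forall>b\<in>{k, k + 1, k + 2, k + 3, k + 4}. X k a b = 0"
    by (simp only: ball_simps z z[THEN rev] zero zero' self simp_thms)
  then show ?thesis
    unfolding vertex_UNIV[OF d[of k], symmetric] by simp
qed

lemma generic_no_nonzero_flow: "generic no_nonzero_flow"
proof -
  define x :: "complex^(vertex \<times> vertex \<times> var) \<Rightarrow> vertex \<Rightarrow> vertex \<Rightarrow> complex^var" where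
    "x = (\<lambda>u i j. \<chi> p. u $ (i, j, p))"
  \<comment> \<open>The three blocks are vanishing at tetrahedron \<open>i\<close>, antisymmetry and
    conservation. Vanishing at \<open>j\<close> is implied by antisymmetry and the first
    block.\<close>
  define L :: "complex^var^var \<Rightarrow> complex^(vertex \<times> vertex \<times> var) \<Rightarrow>
      complex^((vertex \<times> vertex \<times> (2 + 2)) + (vertex \<times> vertex \<times> var) + (vertex \<times> var))" where
    "L = (\<lambda>F u. \<chi> m. case m of
            Inl (i, j, r) \<Rightarrow> graph_op F (x u i j) $ (i, r)
          | Inr (Inl (i, j, p)) \<Rightarrow> u $ (i, j, p) + u $ (j, i, p)
          | Inr (Inr (i, p)) \<Rightarrow> \<Sum>j\<in>UNIV. u $ (i, j, p))"
  define F0 :: "complex^var^var" where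
    "F0 = (\<chi> p q. if snd p = snd q \<and> (fst q = fst p + 1 \<or> fst p = fst q + 1) then 1 else 0)"
  have x_lin: "x (u + v) i j = x u i j + x v i j" "x (c *s u) i j = c *s x u i j" for u v c i j
    by (simp_all add: x_def vec_eq_iff)
  have "generic (\<lambda>F. \<forall>u. L F u = 0 \<longrightarrow> u = 0)"
  proof (rule generic_injective[where ?F0.0 = F0])
    show "Vector_Spaces.linear (*s) (*s) (L F)" for F
      unfolding Vector_Spaces.linear_iff
      by (auto simp: vec.vector_space_axioms L_def x_lin graph_op_add graph_op_scale vec_eq_iff
          sum.distrib sum_distrib_left algebra_simps split: sum.split)
    show "poly_fun matrix_entries (\<lambda>F. L F (axis n 1) $ m)" for n m
    proof -
      consider i j r where "m = Inl (i, j, r)" | i j p where "m = Inr (Inl (i, j, p))"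
        | i p where "m = Inr (Inr (i, p))"
        by (metis sum.exhaust prod_cases3 surj_pair)
      then show ?thesis
        by cases (simp_all add: L_def x_def poly_fun.const poly_fun_graph_op)
    qed
    show "F0 \<in> symmetric_matrices"
      by (auto simp: symmetric_matrices_def transpose_def vec_eq_iff F0_def)
  next
    fix u assume u: "L F0 u = 0"
    have eqs: "L F0 u $ Inl (i, j, r) = 0" "L F0 u $ Inr (Inl (i, j, p)) = 0"
      "L F0 u $ Inr (Inr (i, p)) = 0" for i j r p
      using u by simp_all
    have "u $ (i, j, (k, a)) = 0" for i j k a
    proof (rule flow_of_five_cycle_eq_0[of "\<lambda>k i j. u $ (i, j, (k, a))"])
      show "u $ (j, i, (k, a)) = - u $ (i, j, (k, a))" for k i j
        using eqs(2)[of i j "(k, a)"] by (simp add: L_def eq_neg_iff_add_eq_0 add.commute)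
      show "u $ (i, j, (i, a)) = 0" for i j
        using eqs(1)[of i j "Inl a"] by (simp add: L_def graph_op_def x_def)
      show "(\<Sum>j\<in>UNIV. u $ (i, j, (k, a))) = 0" for k i
        using eqs(3)[of i "(k, a)"] by (simp add: L_def)
      \<comment> \<open>This is the row of multiplication coefficients at tetrahedron
        \<open>i\<close>; modulo 5, \<open>i + 4\<close> is the other neighbour \<open>i - 1\<close>
        in the cycle.\<close>
      show "u $ (i, j, (i + 1, a)) + u $ (i, j, (i + 4, a)) = 0" for i j
      proof -
        have d: "distinct [i, i + 1, i + 2, i + 3, i + 4]" by simp
        have "i = i + 4 + 1" by simp
        then show ?thesis
          using eqs(1)[of i j "Inr a"] exhaust_2[of a]
          by (auto simp: L_def graph_op_def x_def F0_def sum_var sum_vertex[OF d] add.assoc)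
      qed
    qed
    then show "u = 0" by (simp add: vec_eq_iff)
  qed
  then show ?thesis
  proof (rule generic_mono)
    fix F assume inj: "\<forall>u. L F u = 0 \<longrightarrow> u = 0"
    show "no_nonzero_flow F"
      unfolding no_nonzero_flow_def
    proof (intro allI impI, elim conjE)
      fix y :: "vertex \<Rightarrow> vertex \<Rightarrow> pent_op" and i j
      assume E: "\<forall>i j. y i j \<in> edge_space F {i, j}" and anti: "\<forall>i j. y j i = - y i j"
        and div: "\<forall>i. (\<Sum>j\<in>UNIV. y i j) = 0"
      have "\<exists>v. y i j = graph_op F v" for i j
        using E by (auto simp: edge_space_iff V_L_eq_range)
      then obtain v where v: "\<And>i j. y i j = graph_op F (v i j)" by metis
      define u :: "complex^(vertex \<times> vertex \<times> var)" where
        "u = (\<chi> m. case m of (i, j, p) \<Rightarrow> v i j $ p)"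
      have xu: "x u i j = v i j" for i j by (simp add: x_def u_def vec_eq_iff)
      have uy: "u $ (i, j, (s, a)) = y i j $ (s, Inl a)" for i j s a
        by (simp add: u_def v graph_op_def)
      have "L F u $ m = 0" for m
      proof -
        have "graph_op F (v i j) $ (i, r) = 0" for i j r
          using E by (auto simp: v edge_space_iff comp_op_def vec_eq_iff)
        moreover have "u $ (i, j, p) + u $ (j, i, p) = 0" for i j p
          using anti[rule_format, of i j] by (cases p) (simp add: uy)
        moreover have "(\<Sum>j\<in>UNIV. u $ (i, j, p)) = 0" for i p
          using div by (cases p) (simp add: uy flip: sum_component)
        ultimately show ?thesis
          by (auto simp: L_def xu split: sum.split prod.split)
      qed
      then have "u = 0" using inj by (simp add: vec_eq_iff)
      then have "v i j = 0" using xu[of i j] by (simp add: x_def vec_eq_iff)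
      then show "y i j = 0" by (simp add: v graph_op_zero)
    qed
  qed
qed

section \<open>Geometry of a single tetrahedron\<close>

lemma tet_op_basis:
  fixes v1 v2 v3 v4 :: tet_op
  assumes ind: "\<And>x1 x2 x3 x4. x1 *s v1 + x2 *s v2 + x3 *s v3 + x4 *s v4 = 0 \<Longrightarrow>
                 x1 = 0 \<and> x2 = 0 \<and> x3 = 0 \<and> x4 = 0"
  shows tet_op_basis_span: "\<exists>x1 x2 x3 x4. v = x1 *s v1 + x2 *s v2 + x3 *s v3 + x4 *s v4"
    and tet_op_basis_extend: "\<exists>g :: complex^(2 + 2)^(2 + 2). g *v v1 = w1 \<and> g *v v2 = w2 \<and> g *v v3 = w3 \<and> g *v v4 = w4"
proof -
  define T :: "tet_op \<Rightarrow> tet_op \<Rightarrow> tet_op \<Rightarrow> tet_op \<Rightarrow> tet_op \<Rightarrow> tet_op" where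
    "T = (\<lambda>v1 v2 v3 v4 x. x $ Inl 1 *s v1 + x $ Inl 2 *s v2 + x $ Inr 1 *s v3 + x $ Inr 2 *s v4)"
  have lin: "Vector_Spaces.linear (*s) (*s) (T v1 v2 v3 v4)" for v1 v2 v3 v4
    by (simp add: Vector_Spaces.linear_iff vec.vector_space_axioms T_def vec_eq_iff algebra_simps)
  have "x = 0" if "T v1 v2 v3 v4 x = 0" for x
  proof -
    have "x $ Inl 1 = 0 \<and> x $ Inl 2 = 0 \<and> x $ Inr 1 = 0 \<and> x $ Inr 2 = 0"
      using ind that unfolding T_def by blast
    then have "x $ k = 0" for k
      by (cases k) (metis exhaust_2)+
    then show ?thesis by (simp add: vec_eq_iff)
  qed
  then have inj: "inj (T v1 v2 v3 v4)"
    by (simp add: vec.linear_inj_iff_eq_0[OF lin])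
  then have "surj (T v1 v2 v3 v4)"
    by (rule vec.linear_inj_imp_surj[OF lin])
  then obtain x where "v = T v1 v2 v3 v4 x"
    by (rule surjE)
  then show "\<exists>x1 x2 x3 x4. v = x1 *s v1 + x2 *s v2 + x3 *s v3 + x4 *s v4"
    unfolding T_def by blast
  obtain h where h: "Vector_Spaces.linear (*s) (*s) h" "h \<circ> T v1 v2 v3 v4 = id"
    using vec.linear_injective_left_inverse[OF lin inj] by blast
  define g where "g = matrix (T w1 w2 w3 w4 \<circ> h)"
  have "g *v T v1 v2 v3 v4 x = T w1 w2 w3 w4 x" for x
    unfolding g_def using h
    by (subst matrix_works[OF Vector_Spaces.linear_compose[OF h(1) lin]]) (metis comp_apply id_apply)
  from this[of "axis (Inl 1) 1"] this[of "axis (Inl 2) 1"] this[of "axis (Inr 1) 1"] this[of "axis (Inr 2) 1"]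
  show "\<exists>g :: complex^(2 + 2)^(2 + 2). g *v v1 = w1 \<and> g *v v2 = w2 \<and> g *v v3 = w3 \<and> g *v v4 = w4"
    by (intro exI[of _ g]) (simp add: T_def axis_def)
qed

lemma subspace_edge_space: "vec.subspace (edge_space F b)"
  using subspace_V_L[of F]
  by (auto simp: vec.subspace_def edge_space_iff comp_op_add comp_op_scale comp_op_zero)

text \<open>In the isotropy sum, \<open>x\<close> kills the terms \<open>i, j\<close> and
  \<open>y\<close> the terms \<open>k, l\<close>, so only the term \<open>t\<close>
  survives.\<close>

lemma opposite_edges_orthogonal:
  assumes F: "F \<in> symmetric_matrices" and d: "distinct [i, j, k, l, t]"
    and "x \<in> edge_space F {i, j}" "y \<in> edge_space F {k, l}"
  shows "sympl (comp_op t x) (comp_op t y) = 0"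
  using V_L_isotropic[OF F, of x y] assms(3,4)
  by (auto simp: edge_space_iff sum_vertex[OF d] sympl_zero_left sympl_zero_right)

lemma adjacent_edges_isotropic:
  assumes F: "F \<in> symmetric_matrices" and d: "distinct [i, j, k, l, t]"
    and "x \<in> edge_space F {i, j}" "y \<in> edge_space F {i, k}"
  shows "sympl (comp_op l x) (comp_op l y) = - sympl (comp_op t x) (comp_op t y)"
  using V_L_isotropic[OF F, of x y] assms(3,4)
  by (auto simp: edge_space_iff sum_vertex[OF d] sympl_zero_left sympl_zero_right eq_neg_iff_add_eq_0)

section \<open>Scalar vertex relations: Cramer coefficients and holonomies\<close>

text \<open>The vertex relations of a tetrahedron with vertices \<open>i, j, k, l\<close> are a linear system for the
  vectors of the remaining four edges in terms of those of \<open>ij\<close> and \<open>kl\<close>; \<open>tet_det\<close> is its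
  determinant, and Cramer's rule gives the coefficients of the vector of \<open>ik\<close>.\<close>

definition tet_det :: "(vertex \<Rightarrow> vertex \<Rightarrow> complex) \<Rightarrow> vertex \<Rightarrow> vertex \<Rightarrow> vertex \<Rightarrow> vertex \<Rightarrow> complex" where
  "tet_det a i j k l = a i k * a k j * a j l * a l i - a k i * a j k * a l j * a i l"

definition coeff1 :: "(vertex \<Rightarrow> vertex \<Rightarrow> complex) \<Rightarrow> vertex \<Rightarrow> vertex \<Rightarrow> vertex \<Rightarrow> vertex \<Rightarrow> complex" where
  "coeff1 a i j k l =
     - (a i j * a l i * a j l * a k j + a i l * a l j * a j i * a k j) / tet_det a i j k l"

definition coeff2 :: "(vertex \<Rightarrow> vertex \<Rightarrow> complex) \<Rightarrow> vertex \<Rightarrow> vertex \<Rightarrow> vertex \<Rightarrow> vertex \<Rightarrow> complex" where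
  "coeff2 a i j k l =
     (a i l * a l k * a j l * a k j + a i l * a l j * a j k * a k l) / tet_det a i j k l"

text \<open>The diagonal entry of \<open>holonomy\<close> when \<open>a\<close> consists of the
  corresponding diagonal entries of the matrices \<open>A\<close>.\<close>

definition triangle_hol :: "(vertex \<Rightarrow> vertex \<Rightarrow> complex) \<Rightarrow> vertex \<Rightarrow> vertex \<Rightarrow> vertex \<Rightarrow> complex" where
  "triangle_hol a i j k =
     inverse (a j i) * a j k * inverse (a k j) * a k i * inverse (a i k) * a i j"

text \<open>Diagonality of the \<open>A i j\<close> decouples the two rows: \<open>a\<close> and
  \<open>c\<close> are the first and second diagonal entries. The cocycle is left out, so that the
  edge vectors and relations can be rescaled freely.\<close>

locale pentachoron =
  fixes F :: "complex^var^var" and e f :: "vertex set \<Rightarrow> pent_op"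
    and a c :: "vertex \<Rightarrow> vertex \<Rightarrow> complex"
  assumes sym: "F \<in> symmetric_matrices"
    and opp: "opposite_edges_independent F"
    and noflow: "no_nonzero_flow F"
    and e_in: "i \<noteq> j \<Longrightarrow> e {i, j} \<in> edge_space F {i, j}"
    and f_in: "i \<noteq> j \<Longrightarrow> f {i, j} \<in> edge_space F {i, j}"
    and indep: "i \<noteq> j \<Longrightarrow> x *s e {i, j} + y *s f {i, j} = 0 \<Longrightarrow> x = 0 \<and> y = 0"
    and spanned: "i \<noteq> j \<Longrightarrow> d \<in> edge_space F {i, j} \<Longrightarrow> \<exists>x y. d = x *s e {i, j} + y *s f {i, j}"
    and a_nz: "i \<noteq> j \<Longrightarrow> a i j \<noteq> 0" and c_nz: "i \<noteq> j \<Longrightarrow> c i j \<noteq> 0"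
    and e_rel: "(\<Sum>j\<in>- {i}. a i j *s e {i, j}) = 0"
    and f_rel: "(\<Sum>j\<in>- {i}. c i j *s f {i, j}) = 0"
begin

lemma swap: "pentachoron F f e c a"
proof (rule pentachoron.intro)
  fix i j :: vertex and x y assume "i \<noteq> j" "x *s f {i, j} + y *s e {i, j} = 0"
  then show "x = 0 \<and> y = 0" using indep[of i j y x] by (simp add: add.commute)
next
  fix i j :: vertex and d assume "i \<noteq> j" "d \<in> edge_space F {i, j}"
  then obtain x y where "d = x *s e {i, j} + y *s f {i, j}" using spanned by blast
  then have "d = y *s f {i, j} + x *s e {i, j}" by (simp add: add.commute)
  then show "\<exists>x y. d = x *s f {i, j} + y *s e {i, j}" by blast
qed (fact sym opp noflow e_rel f_rel | rule e_in f_in a_nz c_nz, assumption)+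

text \<open>The data are symmetric under exchanging \<open>e, a\<close> with \<open>f, c\<close>;
  each fact about \<open>e\<close> and \<open>a\<close> is thus available for \<open>f\<close> and
  \<open>c\<close> with the prefix \<open>sw\<close>.\<close>

sublocale sw: pentachoron F f e c a
  by (rule swap)

lemma comp_e_zero: "i \<noteq> j \<Longrightarrow> comp_op i (e {i, j}) = 0" "i \<noteq> j \<Longrightarrow> comp_op j (e {i, j}) = 0"
  using e_in[of i j] by (auto simp: edge_space_iff)

lemma vertex_relation:
  assumes d: "distinct [i, j, k, l, t]"
  shows "a i j *s e {i, j} + a i k *s e {i, k} + a i l *s e {i, l} + a i t *s e {i, t} = 0"
proof -
  have "- {i} = {j, k, l, t}" using vertex_UNIV[OF d] d by auto
  then show ?thesis using e_rel[of i] d by (simp add: add.assoc)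
qed

text \<open>Projecting the relation at \<open>i\<close> to \<open>V\<^sub>t\<close> removes the edge
  \<open>it\<close>, which does not lie in the tetrahedron opposite to \<open>t\<close>.\<close>

lemma tet_relation:
  assumes d: "distinct [i, j, k, l, t]"
  shows "a i j *s comp_op t (e {i, j}) + a i k *s comp_op t (e {i, k}) + a i l *s comp_op t (e {i, l}) = 0"
  using arg_cong[OF vertex_relation[OF d], of "comp_op t"] d
  by (simp add: comp_op_add comp_op_scale comp_op_zero comp_e_zero)

lemma opposite_basis:
  assumes d: "distinct [i, j, k, l, t]"
    and eq: "x1 *s comp_op t (e {i, j}) + x2 *s comp_op t (f {i, j})
             + x3 *s comp_op t (e {k, l}) + x4 *s comp_op t (f {k, l}) = 0"
  shows "x1 = 0 \<and> x2 = 0 \<and> x3 = 0 \<and> x4 = 0"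
proof -
  have ne: "i \<noteq> j" "k \<noteq> l" using d by auto
  define x where "x = x1 *s e {i, j} + x2 *s f {i, j}"
  define y where "y = (- x3) *s e {k, l} + (- x4) *s f {k, l}"
  have "x \<in> edge_space F {i, j}" "y \<in> edge_space F {k, l}"
    unfolding x_def y_def using ne e_in f_in
    by (intro vec.subspace_add vec.subspace_scale subspace_edge_space; blast)+
  moreover have "comp_op t x = comp_op t y"
    using eq unfolding x_def y_def comp_op_add comp_op_scale
    by (simp add: vec_eq_iff eq_diff_eq eq_neg_iff_add_eq_0 algebra_simps)
  ultimately have "x = 0" "y = 0"
    using opp d unfolding opposite_edges_independent_def by blast+
  then show ?thesis
    unfolding x_def y_def using indep[OF ne(1)] indep[OF ne(2)] by (metis neg_equal_0_iff_equal)
qed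

lemma orthogonal:
  assumes d: "distinct [i, j, k, l, t]"
  shows "sympl (comp_op t (e {i, j})) (comp_op t (e {k, l})) = 0"
    "sympl (comp_op t (e {i, j})) (comp_op t (f {k, l})) = 0"
    "sympl (comp_op t (f {i, j})) (comp_op t (f {k, l})) = 0"
    "sympl (comp_op t (f {i, j})) (comp_op t (e {k, l})) = 0"
  using opposite_edges_orthogonal[OF sym d] d by (auto intro: e_in f_in)

text \<open>Otherwise the component of \<open>e {i, j}\<close> would be orthogonal to all four
  vectors of a basis of \<open>V\<^sub>t\<close>, contrary to nondegeneracy.\<close>

lemma sympl_edge_nonzero:
  assumes d: "distinct [i, j, k, l, t]"
  shows "sympl (comp_op t (e {i, j})) (comp_op t (f {i, j})) \<noteq> 0"
proof
  assume 0: "sympl (comp_op t (e {i, j})) (comp_op t (f {i, j})) = 0"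
  have "comp_op t (e {i, j}) = 0"
  proof (rule sympl_nondegenerate)
    fix w
    obtain x1 x2 x3 x4 where "w = x1 *s comp_op t (e {i, j}) + x2 *s comp_op t (f {i, j})
             + x3 *s comp_op t (e {k, l}) + x4 *s comp_op t (f {k, l})"
      using tet_op_basis_span[OF opposite_basis[OF d]] by blast
    then show "sympl (comp_op t (e {i, j})) w = 0"
      by (simp add: sympl_add_right sympl_scale_right sympl_self 0 orthogonal[OF d])
  qed
  then show False using opposite_basis[OF d, of 1 0 0 0] by simp
qed

text \<open>If the determinant vanished, the holonomy would be \<open>-1\<close> on all faces of the tetrahedron, and the
  relations could be scaled by factors \<open>m\<close> so that the \<open>m i * a i j *s e {i, j}\<close> form a nonzero flow.\<close>

lemma tet_det_nonzero:
  assumes d: "distinct [i, j, k, l, t]"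
  shows "tet_det a i j k l \<noteq> 0"
proof
  assume D: "tet_det a i j k l = 0"
  have ne: "i \<noteq> j" "i \<noteq> k" "i \<noteq> l" "i \<noteq> t" "j \<noteq> k" "j \<noteq> l" "j \<noteq> t" "k \<noteq> l" "k \<noteq> t" "l \<noteq> t"
    using d by auto
  note ne = ne ne[symmetric]
  \<comment> \<open>With \<open>m i = 1\<close>, the other factors are chosen to make the scaled
    coefficients antisymmetric on \<open>ik\<close>, \<open>il\<close> and \<open>jk\<close>.
    Antisymmetry on \<open>jl\<close> is then exactly \<open>D\<close>.\<close>
  define mk where "mk = - a i k / a k i"
  define ml where "ml = - a i l / a l i"
  define mj where "mj = - mk * a k j / a j k"
  define m where "m = (\<lambda>v. if v = i then 1 else if v = j then mj else if v = k then mk else ml)"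
  have m: "m i = 1" "m j = mj" "m k = mk" "m l = ml" using ne by (simp_all add: m_def)
  have m0: "m v \<noteq> 0" if "v \<noteq> t" for v
    using that a_nz ne by (auto simp: m_def mk_def ml_def mj_def)
  have ik: "a i k + mk * a k i = 0" and il: "a i l + ml * a l i = 0" and jk: "mj * a j k + mk * a k j = 0"
    using a_nz ne by (simp_all add: mk_def ml_def mj_def)
  have jl: "mj * a j l + ml * a l j = 0"
    using D a_nz ne by (simp add: tet_det_def mk_def ml_def mj_def field_simps)
  \<comment> \<open>In the sum of the four relations weighted by \<open>m\<close>, the edges
    \<open>ik, il, jk, jl\<close> cancel. Independence of the two remaining opposite edges gives
    antisymmetry there too.\<close>
  have "(m i * a i j + m j * a j i) *s comp_op t (e {i, j}) + (m k * a k l + m l * a l k) *s comp_op t (e {k, l}) = 0"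
  proof -
    have "(m i * a i j + m j * a j i) * E i j + (m k * a k l + m l * a l k) * E k l = 0"
      if "a i j * E i j + a i k * E i k + a i l * E i l = 0"
        "a j i * E i j + a j k * E j k + a j l * E j l = 0"
        "a k i * E i k + a k j * E j k + a k l * E k l = 0"
        "a l i * E i l + a l j * E j l + a l k * E k l = 0" for E :: "vertex \<Rightarrow> vertex \<Rightarrow> complex"
      using that ik il jk jl unfolding m by algebra
    note * = this[of "\<lambda>u v. comp_op t (e {u, v}) $ n" for n]
    have "distinct [j, i, k, l, t]" "distinct [k, i, j, l, t]" "distinct [l, i, j, k, t]"
      using d by auto
    note R = d this
    show ?thesis
      unfolding vec_eq_iff vector_add_component vector_smult_component zero_index
      using R[THEN tet_relation, THEN arg_cong[where f = "\<lambda>v. v $ _"]] *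
      by (simp add: insert_commute)
  qed
  then have *: "m i * a i j + m j * a j i = 0 \<and> m k * a k l + m l * a l k = 0"
    using opposite_basis[OF d, of "m i * a i j + m j * a j i" 0 "m k * a k l + m l * a l k" 0] by simp
  have anti: "m v * a v u = - (m u * a u v)" if "u \<noteq> t" "v \<noteq> t" "u \<noteq> v" for u v
  proof -
    have eqs: "mk * a k i = - a i k" "ml * a l i = - a i l" "mj * a j k = - (mk * a k j)"
      "mj * a j l = - (ml * a l j)" "mj * a j i = - a i j" "mk * a k l = - (ml * a l k)"
      using * ik il jk jl by (simp_all add: m eq_neg_iff_add_eq_0 add.commute)
    have "u \<in> {i, j, k, l}" "v \<in> {i, j, k, l}"
      using that vertex_UNIV[OF d] by blast+
    then show ?thesis
      using that(3) by (elim insertE emptyE) (simp_all only: m eqs minus_minus mult_1 simp_thms)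
  qed
  \<comment> \<open>On edges at \<open>t\<close> antisymmetry is imposed by definition: the
    coefficient comes from the relation at the end other than \<open>t\<close>. Conservation is
    thereby immediate at all vertices except \<open>t\<close>.\<close>
  define w where "w = (\<lambda>u v. if v = t then m u * a u v else if u = t then - (m v * a v u) else m u * a u v)"
  define x where "x = (\<lambda>u v. if u = v then 0 else w u v *s e {u, v})"
  have x_anti: "x v u = - x u v" for u v
    using anti[of u v] by (auto simp: x_def w_def insert_commute vec_eq_iff)
  have x_in: "x u v \<in> edge_space F {u, v}" for u v
    using e_in[of u v] subspace_edge_space[of F "{u, v}"] by (auto simp: x_def vec.subspace_def)
  have div: "(\<Sum>v\<in>UNIV. x u v) = 0" if "u \<noteq> t" for u
  proof -
    have "(\<Sum>v\<in>UNIV. x u v) = (\<Sum>v\<in>- {u}. x u v)"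
      by (rule sum.mono_neutral_right) (auto simp: x_def)
    also have "\<dots> = (\<Sum>v\<in>- {u}. m u *s (a u v *s e {u, v}))"
      using that by (intro sum.cong) (auto simp: x_def w_def vec_eq_iff)
    also have "\<dots> = m u *s (\<Sum>v\<in>- {u}. a u v *s e {u, v})"
      by (rule vec.scale_sum_right[symmetric])
    finally show ?thesis by (simp add: e_rel)
  qed
  \<comment> \<open>The divergences of an antisymmetric family add up to 0, so conservation at four
    vertices implies it at \<open>t\<close>.\<close>
  have "(\<Sum>u\<in>UNIV. \<Sum>v\<in>UNIV. x u v) = - (\<Sum>u\<in>UNIV. \<Sum>v\<in>UNIV. x u v)"
  proof -
    have "(\<Sum>u\<in>UNIV. \<Sum>v\<in>UNIV. x u v) = (\<Sum>v\<in>UNIV. \<Sum>u\<in>UNIV. x u v)"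
      by (rule sum.swap)
    also have "\<dots> = (\<Sum>v\<in>UNIV. \<Sum>u\<in>UNIV. - x v u)"
      by (intro sum.cong refl x_anti)
    finally show ?thesis by (simp add: sum_negf)
  qed
  moreover have "(\<Sum>u\<in>UNIV. \<Sum>v\<in>UNIV. x u v) = (\<Sum>v\<in>UNIV. x t v)"
    unfolding sum_vertex[OF d, of "\<lambda>u. \<Sum>v\<in>UNIV. x u v"] using ne by (simp add: div)
  moreover have "S = 0" if "S = - S" for S :: pent_op
  proof -
    have "S $ n = 0" for n
      using arg_cong[OF that, of "\<lambda>v. v $ n"] by (simp add: complex_eq_iff)
    then show ?thesis by (simp add: vec_eq_iff)
  qed
  ultimately have "(\<Sum>v\<in>UNIV. x t v) = 0" by simp
  then have "(\<Sum>v\<in>UNIV. x u v) = 0" for u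
    by (cases "u = t") (simp_all add: div)
  then have "x i j = 0"
    using noflow[unfolded no_nonzero_flow_def, THEN spec, of x] x_in x_anti by blast
  then have "a i j *s e {i, j} + 0 *s f {i, j} = 0"
    using ne by (simp add: x_def w_def m)
  then show False using indep ne a_nz by blast
qed

lemma tet_coeff:
  assumes d: "distinct [i, j, k, l, t]"
  shows "comp_op t (e {i, k}) =
    coeff1 a i j k l *s comp_op t (e {i, j}) + coeff2 a i j k l *s comp_op t (e {k, l})"
proof -
  have "comp_op t (e {i, k}) $ n =
     coeff1 a i j k l * comp_op t (e {i, j}) $ n + coeff2 a i j k l * comp_op t (e {k, l}) $ n" for n
  proof -
    let ?D = "tet_det a i j k l"
    let ?X = "- (a i j * a l i * a j l * a k j + a i l * a l j * a j i * a k j)"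
    let ?Y = "a i l * a l k * a j l * a k j + a i l * a l j * a j k * a k l"
    have solve: "z = X / D * p + Y / D * q" if "D \<noteq> 0" "D * z = X * p + Y * q" for D z X Y p q :: complex
      using that by (simp add: field_simps)
    define E where "E = (\<lambda>b. comp_op t (e b) $ n)"
    have "distinct [j, i, k, l, t]" "distinct [k, i, j, l, t]" "distinct [l, i, j, k, t]"
      using d by auto
    note R = d this
    have R1: "a i j * E {i, j} + a i k * E {i, k} + a i l * E {i, l} = 0"
      and R2: "a j i * E {i, j} + a j k * E {j, k} + a j l * E {j, l} = 0"
      and R3: "a k i * E {i, k} + a k j * E {j, k} + a k l * E {k, l} = 0"
      and R4: "a l i * E {i, l} + a l j * E {j, l} + a l k * E {k, l} = 0"
      using R[THEN tet_relation, THEN arg_cong[where f = "\<lambda>v. v $ n"]]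
      by (simp_all add: E_def insert_commute)
    have "?D * E {i, k} = ?X * E {i, j} + ?Y * E {k, l}"
      unfolding tet_det_def using R1 R2 R3 R4 by algebra
    then show ?thesis
      unfolding coeff1_def coeff2_def E_def by (rule solve[OF tet_det_nonzero[OF d]])
  qed
  then show ?thesis by (simp add: vec_eq_iff)
qed

text \<open>The relation at \<open>i\<close> is paired with \<open>f {j, k}\<close>; the term of
  \<open>il\<close> drops out because \<open>il\<close> and \<open>jk\<close> are opposite.\<close>

lemma sympl_relation:
  assumes d: "distinct [i, j, k, l, t]"
  shows "a i j * sympl (comp_op t (e {i, j})) (comp_op t (f {j, k}))
       + a i k * sympl (comp_op t (e {i, k})) (comp_op t (f {j, k})) = 0"
proof -
  have "distinct [i, l, j, k, t]" using d by auto
  from orthogonal(2)[OF this]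
  show ?thesis
    using arg_cong[OF tet_relation[OF d], of "\<lambda>v. sympl v (comp_op t (f {j, k}))"]
    by (simp add: sympl_add_left sympl_scale_left sympl_zero_left)
qed

end

section \<open>Nonvanishing coefficients and inverse holonomies\<close>

context pentachoron
begin

text \<open>If \<open>e {i, k}\<close> were parallel to \<open>e {k, l}\<close> in \<open>V\<^sub>t\<close>, so would be \<open>e {j, k}\<close>; by orthogonality \<open>f {j, l}\<close>
  and \<open>f {i, l}\<close>, hence also \<open>f {k, l}\<close>, would be parallel to \<open>f {i, j}\<close>.\<close>

lemma coeff1_nonzero:
  assumes d: "distinct [i, j, k, l, t]"
  shows "coeff1 a i j k l \<noteq> 0"
proof
  assume 0: "coeff1 a i j k l = 0"
  have ne: "i \<noteq> j" "i \<noteq> k" "i \<noteq> l" "i \<noteq> t" "j \<noteq> k" "j \<noteq> l" "j \<noteq> t" "k \<noteq> l" "k \<noteq> t" "l \<noteq> t"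
    using d by auto
  note ne = ne ne[symmetric]
  have d': "distinct [i, k, j, l, t]" "distinct [j, k, i, l, t]" "distinct [j, i, l, k, t]"
    "distinct [i, j, l, k, t]" "distinct [k, i, j, l, t]" "distinct [l, i, j, k, t]" "distinct [k, l, i, j, t]"
    using d by auto
  define y where "y = coeff2 a i j k l"
  have ik: "comp_op t (e {i, k}) = y *s comp_op t (e {k, l})"
    using tet_coeff[OF d] by (simp add: 0 y_def)
  have y: "y \<noteq> 0"
    using ik opposite_basis[OF d'(1), of 1 0 0 0] by auto
  define z where "z = - (a k i * y + a k l) / a k j"
  have z': "a k j * z = - (a k i * y + a k l)"
    using a_nz[of k j] ne by (simp add: z_def)
  have "comp_op t (e {j, k}) $ n = z * comp_op t (e {k, l}) $ n" for n
  proof -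
    have "a k i * (y * comp_op t (e {k, l}) $ n) + a k j * comp_op t (e {j, k}) $ n
        + a k l * comp_op t (e {k, l}) $ n = 0"
      using arg_cong[OF tet_relation[OF d'(5)], of "\<lambda>v. v $ n"] arg_cong[OF ik, of "\<lambda>v. v $ n"]
      by (simp add: insert_commute)
    then have "a k j * comp_op t (e {j, k}) $ n = a k j * (z * comp_op t (e {k, l}) $ n)"
      using z' by algebra
    then show ?thesis using a_nz[of k j] ne by simp
  qed
  then have jk: "comp_op t (e {j, k}) = z *s comp_op t (e {k, l})"
    by (simp add: vec_eq_iff)
  have z: "z \<noteq> 0"
    using jk opposite_basis[OF d'(2), of 1 0 0 0] by auto
  have jl: "comp_op t (f {j, l}) =
      coeff1 c j i l k *s comp_op t (f {i, j}) + coeff2 c j i l k *s comp_op t (f {k, l})"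
    using sw.tet_coeff[OF d'(3)] by (simp add: insert_commute)
  have il: "comp_op t (f {i, l}) =
      coeff1 c i j l k *s comp_op t (f {i, j}) + coeff2 c i j l k *s comp_op t (f {k, l})"
    using sw.tet_coeff[OF d'(4)] by (simp add: insert_commute)
  note B = sympl_add_right sympl_scale_right sympl_scale_left
  have q: "sympl (comp_op t (e {k, l})) (comp_op t (f {k, l})) \<noteq> 0"
    by (rule sympl_edge_nonzero[OF d'(7)])
  \<comment> \<open>Inserting the expansions into the orthogonality of the opposite edges
    \<open>ik\<close> and \<open>jl\<close> leaves only \<open>y * coeff2 c j i l k * q = 0\<close>,
    where \<open>q\<close> denotes the nonzero product on \<open>kl\<close>.\<close>
  have 1: "coeff2 c j i l k = 0"
    using orthogonal(2)[OF d'(1)] orthogonal(2)[OF d'(7)] y q by (simp add: ik jl B)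
  have 2: "coeff2 c i j l k = 0"
    using orthogonal(2)[OF d'(2)] orthogonal(2)[OF d'(7)] z q by (simp add: jk il B)
  \<comment> \<open>The relation of the \<open>f\<close> vectors at \<open>l\<close>, now written in
    the basis of \<open>ij\<close> and \<open>kl\<close>, has the coefficient \<open>c l k\<close>
    at \<open>f {k, l}\<close>.\<close>
  have "0 *s comp_op t (e {i, j}) + (c l i * coeff1 c i j l k + c l j * coeff1 c j i l k) *s comp_op t (f {i, j})
        + 0 *s comp_op t (e {k, l}) + c l k *s comp_op t (f {k, l}) = 0"
    using sw.tet_relation[OF d'(6)]
    by (simp add: 1 2 il jl insert_commute vec.scale_left_distrib add.assoc)
  from opposite_basis[OF d this] have "c l k = 0" by simp
  then show False using c_nz ne by simp
qed

end

context pentachoron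
begin

text \<open>Exchanging the opposite edges \<open>ij\<close> and \<open>kl\<close> by
  \<open>(i, j, k, l)\<close> to \<open>(k, l, i, j)\<close> fixes the edge \<open>ik\<close> and
  turns \<open>coeff2\<close> into \<open>coeff1\<close>.\<close>

lemma coeff2_nonzero:
  assumes d: "distinct [i, j, k, l, t]"
  shows "coeff2 a i j k l \<noteq> 0"
proof -
  have det: "tet_det a k l i j = - tet_det a i j k l"
    by (simp add: tet_det_def algebra_simps)
  have num: "a i l * a l k * a j l * a k j + a i l * a l j * a j k * a k l
      = a k l * a j k * a l j * a i l + a k j * a j l * a l k * a i l"
    by (simp add: algebra_simps)
  have "coeff2 a i j k l = coeff1 a k l i j"
    unfolding coeff1_def coeff2_def det num by (rule minus_divide_divide[symmetric])
  moreover have "distinct [k, l, i, j, t]" using d by auto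
  ultimately show ?thesis using coeff1_nonzero by metis
qed

text \<open>Expanding \<open>f {i, k}\<close> in \<open>f {i, j}\<close> and
  \<open>f {k, l}\<close>, the product is \<open>coeff1 c i j k l\<close> times the nonzero product
  on \<open>ij\<close>.\<close>

lemma sympl_adjacent_nonzero:
  assumes d: "distinct [i, j, k, l, t]"
  shows "sympl (comp_op t (e {i, j})) (comp_op t (f {i, k})) \<noteq> 0"
  using sw.coeff1_nonzero[OF d] sympl_edge_nonzero[OF d]
  by (simp add: sw.tet_coeff[OF d] sympl_add_right sympl_scale_right orthogonal[OF d])

text \<open>Let \<open>B\<close> pair the \<open>e\<close> of one side of the triangle with the
  \<open>f\<close> of another inside \<open>V\<^sub>t\<close>. The six pairings form two cyclic
  products \<open>P\<close> and \<open>Q\<close>; the relations of \<open>a\<close> give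
  \<open>triangle_hol a i j k = - Q / P\<close>, those of \<open>c\<close> give
  \<open>triangle_hol c i j k = - P / Q\<close>.\<close>

lemma triangle_hol_inverse:
  assumes d: "distinct [i, j, k, l, t]"
  shows "triangle_hol c i j k = inverse (triangle_hol a i j k)"
proof -
  have ne: "i \<noteq> j" "i \<noteq> k" "j \<noteq> k" "j \<noteq> i" "k \<noteq> i" "k \<noteq> j" using d by auto
  define B where "B = (\<lambda>b b'. sympl (comp_op t (e b)) (comp_op t (f b')))"
  have d': "distinct [j, k, i, l, t]" "distinct [k, i, j, l, t]" "distinct [j, i, k, l, t]"
     "distinct [k, j, i, l, t]" "distinct [i, k, j, l, t]"
    using d by auto
  have B_sw: "sympl (comp_op t (f b)) (comp_op t (e b')) = - B b' b" for b b'
    unfolding B_def by (rule sympl_commute)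
  have E: "a i j * B {i, j} {j, k} = - (a i k * B {i, k} {j, k})"
    "a j k * B {j, k} {i, k} = - (a j i * B {i, j} {i, k})"
    "a k i * B {i, k} {i, j} = - (a k j * B {j, k} {i, j})"
    using sympl_relation[OF d] sympl_relation[OF d'(1)] sympl_relation[OF d'(2)]
    by (simp_all add: B_def insert_commute eq_neg_iff_add_eq_0)
  have G: "c i j * B {j, k} {i, j} = - (c i k * B {j, k} {i, k})"
    "c j k * B {i, k} {j, k} = - (c j i * B {i, k} {i, j})"
    "c k i * B {i, j} {i, k} = - (c k j * B {i, j} {j, k})"
    using sw.sympl_relation[OF d] sw.sympl_relation[OF d'(1)] sw.sympl_relation[OF d'(2)]
    by (simp_all add: B_sw insert_commute eq_neg_iff_add_eq_0 add_eq_0_iff)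
  have B_nz: "B {i, j} {j, k} \<noteq> 0" "B {j, k} {i, k} \<noteq> 0" "B {i, k} {i, j} \<noteq> 0"
    "B {i, k} {j, k} \<noteq> 0" "B {i, j} {i, k} \<noteq> 0" "B {j, k} {i, j} \<noteq> 0"
    using sympl_adjacent_nonzero[OF d] sympl_adjacent_nonzero[OF d'(1)] sympl_adjacent_nonzero[OF d'(2)]
      sympl_adjacent_nonzero[OF d'(3)] sympl_adjacent_nonzero[OF d'(4)] sympl_adjacent_nonzero[OF d'(5)]
    by (simp_all add: B_def insert_commute)
  define P where "P = B {i, j} {j, k} * B {j, k} {i, k} * B {i, k} {i, j}"
  define Q where "Q = B {i, k} {j, k} * B {i, j} {i, k} * B {j, k} {i, j}"
  have "a i j * a j k * a k i * P = - (a i k * a j i * a k j * Q)"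
    using E unfolding P_def Q_def by algebra
  moreover have "c i j * c j k * c k i * Q = - (c i k * c j i * c k j * P)"
    using G unfolding P_def Q_def by algebra
  moreover have "P \<noteq> 0" "Q \<noteq> 0" using B_nz by (simp_all add: P_def Q_def)
  ultimately have "(c i j * c j k * c k i) * (a i j * a j k * a k i) = (c i k * c j i * c k j) * (a i k * a j i * a k j)"
    by algebra
  moreover have "triangle_hol g i j k = (g i j * g j k * g k i) / (g i k * g j i * g k j)" for g
    by (simp add: triangle_hol_def divide_inverse)
  moreover have "a i k * a j i * a k j \<noteq> 0" "a i j * a j k * a k i \<noteq> 0" "c i k * c j i * c k j \<noteq> 0"
    using a_nz c_nz ne by simp_all
  ultimately show ?thesis
    by (simp only: inverse_divide) (subst frac_eq_eq, simp_all only: not_False_eq_True mult.commute)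
qed

end

section \<open>Comparison of two pentachora\<close>

lemma gauge_action_apply: "comp_op t (gauge_action g d) = g t *v comp_op t d"
  by (simp add: gauge_action_def comp_op_def vec_eq_iff)

lemma gauge_action_linear: "Vector_Spaces.linear (*s) (*s) (gauge_action g)"
  unfolding Vector_Spaces.linear_iff
  by (auto simp: vec.vector_space_axioms gauge_action_apply comp_op_add comp_op_scale
      matrix_vector_right_distrib vec.scale intro!: pent_op_eqI)

lemma obtain_vertices1:
  fixes t :: vertex
  obtains i j k l where "distinct [i, j, k, l, t]"
  by (rule that[of "t + 1" "t + 2" "t + 3" "t + 4"]) simp

lemma obtain_vertices2:
  fixes l t :: vertex
  assumes "l \<noteq> t"
  obtains i j k where "distinct [i, j, k, l, t]"
proof -
  have "card (- {l, t}) = 3" using assms by (simp add: Compl_eq_Diff_UNIV card_Diff_subset)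
  then obtain i j k where "- {l, t} = {i, j, k}" "i \<noteq> j" "j \<noteq> k" "i \<noteq> k"
    by (auto simp: card_3_iff)
  then show ?thesis using assms by (intro that[of i j k]) auto
qed

lemma obtain_vertices3:
  fixes i j k :: vertex
  assumes "i \<noteq> j" "j \<noteq> k" "i \<noteq> k"
  obtains l t where "distinct [i, j, k, l, t]"
proof -
  have "card (- {i, j, k}) = 2" using assms by (simp add: Compl_eq_Diff_UNIV card_Diff_subset)
  then obtain l t where "- {i, j, k} = {l, t}" "l \<noteq> t"
    by (auto simp: card_2_iff)
  then show ?thesis using assms by (intro that[of l t]) auto
qed

section \<open>Spanning by edge vectors, and rescaling\<close>

context pentachoron
begin

text \<open>Edge vectors are subtracted from \<open>d\<close> until its components at 0 and 4
  vanish; the remainder lies in the edge space of \<open>{0, 4}\<close>. Edges \<open>12\<close> and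
  \<open>34\<close> clear the component at 0, then \<open>01\<close> and \<open>02\<close> clear
  that at 4.\<close>

lemma V_L_eq_span: "V_L F = vec.span {x. \<exists>i j. i \<noteq> j \<and> (x = e {i, j} \<or> x = f {i, j})}"
    (is "_ = vec.span ?B")
proof
  have "?B \<subseteq> V_L F" using e_in f_in by (auto simp: edge_space_iff)
  then show span_le: "vec.span ?B \<subseteq> V_L F"
    by (rule vec.span_minimal) (rule subspace_V_L)
  show "V_L F \<subseteq> vec.span ?B"
  proof
    fix d assume dV: "d \<in> V_L F"
    have D: "distinct [1, 2, 3, 4, 0 :: vertex]" and D': "distinct [0, 1, 2, 3, 4 :: vertex]" by simp_all
    have B: "x *s e {i, j} + y *s f {i, j} \<in> vec.span ?B" if "i \<noteq> j" for x y i j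
      using that by (intro vec.span_add vec.span_scale vec.span_base) blast+
    obtain x1 x2 x3 x4 where x: "comp_op 0 d = x1 *s comp_op 0 (e {1, 2}) + x2 *s comp_op 0 (f {1, 2})
             + x3 *s comp_op 0 (e {3, 4}) + x4 *s comp_op 0 (f {3, 4})"
      using tet_op_basis_span[OF opposite_basis[OF D]] by blast
    define u where "u = (x1 *s e {1, 2} + x2 *s f {1, 2}) + (x3 *s e {3, 4} + x4 *s f {3, 4})"
    have u: "u \<in> vec.span ?B" unfolding u_def by (intro vec.span_add B) simp_all
    obtain y1 y2 y3 y4 where y: "comp_op 4 (d - u) = y1 *s comp_op 4 (e {0, 1}) + y2 *s comp_op 4 (f {0, 1})
             + y3 *s comp_op 4 (e {2, 3}) + y4 *s comp_op 4 (f {2, 3})"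
      using tet_op_basis_span[OF opposite_basis[OF D']] by blast
    \<comment> \<open>Edge \<open>23\<close> also lies in tetrahedron 0 and could spoil the
      component already cleared. It is replaced by \<open>02\<close>, which is possible because the
      \<open>coeff2\<close> values are nonzero.\<close>
    define z where "z = coeff1 a 0 1 2 3"
    define z' where "z' = coeff2 a 0 1 2 3"
    define w where "w = coeff1 c 0 1 2 3"
    define w' where "w' = coeff2 c 0 1 2 3"
    have e02: "comp_op 4 (e {0, 2}) = z *s comp_op 4 (e {0, 1}) + z' *s comp_op 4 (e {2, 3})"
      and f02: "comp_op 4 (f {0, 2}) = w *s comp_op 4 (f {0, 1}) + w' *s comp_op 4 (f {2, 3})"
      using tet_coeff[OF D'] sw.tet_coeff[OF D'] by (simp_all add: z_def z'_def w_def w'_def)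
    have nz: "z' \<noteq> 0" "w' \<noteq> 0"
      using coeff2_nonzero[OF D'] sw.coeff2_nonzero[OF D'] by (simp_all add: z'_def w'_def)
    define v where "v = ((y1 - y3 / z' * z) *s e {0, 1} + (y2 - y4 / w' * w) *s f {0, 1})
                      + ((y3 / z') *s e {0, 2} + (y4 / w') *s f {0, 2})"
    have v: "v \<in> vec.span ?B" unfolding v_def by (intro vec.span_add B) simp_all
    have "comp_op 4 (d - u) = comp_op 4 v"
      unfolding v_def y comp_op_add comp_op_scale e02 f02 using nz
      by (simp add: vec_eq_iff field_simps)
    moreover have "comp_op 0 v = 0"
      unfolding v_def comp_op_add comp_op_scale by (simp add: comp_e_zero sw.comp_e_zero)
    moreover have "comp_op 0 (d - u) = 0"
      unfolding comp_op_diff x u_def comp_op_add comp_op_scale by simp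
    ultimately have "comp_op 0 (d - u - v) = 0" "comp_op 4 (d - u - v) = 0"
      by (simp_all only: comp_op_diff diff_self)
    moreover have "d - u - v \<in> V_L F"
      using dV u v span_le by (intro vec.subspace_diff subspace_V_L) auto
    ultimately have "d - u - v \<in> edge_space F {0, 4}"
      by (simp add: edge_space_iff)
    moreover have "(0 :: vertex) \<noteq> 4" by simp
    ultimately obtain p q where "d - u - v = p *s e {0, 4} + q *s f {0, 4}"
      using spanned by blast
    then have "d = (p *s e {0, 4} + q *s f {0, 4}) + (u + v)"
      by (simp add: algebra_simps)
    moreover have "p *s e {0, 4} + q *s f {0, 4} \<in> vec.span ?B" by (rule B) simp
    ultimately show "d \<in> vec.span ?B"
      using u v by (simp add: vec.span_add)
  qed
qed

text \<open>The edge vector of \<open>b\<close> is multiplied by \<open>L b\<close> and the relation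
  at \<open>i\<close> by \<open>m i\<close>; these are the freedoms used to normalise the
  coefficients.\<close>

lemma rescale:
  assumes L: "\<And>b. L b \<noteq> 0" and m: "\<And>i. m i \<noteq> 0"
    and a': "\<And>i j. i \<noteq> j \<Longrightarrow> a' i j * L {i, j} = m i * a i j"
  shows "pentachoron F (\<lambda>b. L b *s e b) f a' c"
proof (rule pentachoron.intro)
  show "L {i, j} *s e {i, j} \<in> edge_space F {i, j}" if "i \<noteq> j" for i j
    using that by (intro vec.subspace_scale subspace_edge_space e_in)
  show "x = 0 \<and> y = 0" if "i \<noteq> j" "x *s (L {i, j} *s e {i, j}) + y *s f {i, j} = 0" for i j x y
    using indep[of i j "x * L {i, j}" y] that L by simp
  show "\<exists>x y. d = x *s (L {i, j} *s e {i, j}) + y *s f {i, j}"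
    if ij: "i \<noteq> j" "d \<in> edge_space F {i, j}" for i j d
  proof -
    obtain x y where "d = x *s e {i, j} + y *s f {i, j}" using spanned[OF ij] by blast
    then show ?thesis
      using L by (intro exI[of _ "x / L {i, j}"] exI[of _ y]) simp
  qed
  show "a' i j \<noteq> 0" if "i \<noteq> j" for i j
    using a'[OF that] m a_nz[OF that] by auto
  show "(\<Sum>j\<in>- {i}. a' i j *s (L {i, j} *s e {i, j})) = 0" for i
  proof -
    have "(\<Sum>j\<in>- {i}. a' i j *s (L {i, j} *s e {i, j})) = (\<Sum>j\<in>- {i}. m i *s (a i j *s e {i, j}))"
      by (intro sum.cong refl) (simp add: a')
    also have "\<dots> = m i *s (\<Sum>j\<in>- {i}. a i j *s e {i, j})"
      by (rule vec.scale_sum_right[symmetric])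
    finally show ?thesis by (simp add: e_rel)
  qed
qed (fact sym opp noflow f_rel | rule f_in c_nz, assumption)+

end

text \<open>By \<open>tet_coeff\<close> the other four edges have the same coefficients, determined
  by \<open>a\<close>, in both pentachora; edges containing \<open>t\<close> have zero component on
  both sides.\<close>

lemma transport_edges:
  assumes P: "pentachoron F e f a c" and P': "pentachoron F' e' f' a c'"
    and d: "distinct [i, j, k, l, t]" and uv: "u \<noteq> v"
    and g: "g *v comp_op t (e {i, j}) = comp_op t (e' {i, j})" "g *v comp_op t (e {k, l}) = comp_op t (e' {k, l})"
  shows "g *v comp_op t (e {u, v}) = comp_op t (e' {u, v})"
proof -
  have d': "distinct [i, j, l, k, t]" "distinct [j, i, k, l, t]" "distinct [j, i, l, k, t]"
    using d by auto
  note lin = matrix_vector_right_distrib vec.scale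
  have eqs: "g *v comp_op t (e {i, k}) = comp_op t (e' {i, k})" "g *v comp_op t (e {i, l}) = comp_op t (e' {i, l})"
    "g *v comp_op t (e {j, k}) = comp_op t (e' {j, k})" "g *v comp_op t (e {j, l}) = comp_op t (e' {j, l})"
    using g pentachoron.tet_coeff[OF P d] pentachoron.tet_coeff[OF P' d]
      pentachoron.tet_coeff[OF P d'(1)] pentachoron.tet_coeff[OF P' d'(1)]
      pentachoron.tet_coeff[OF P d'(2)] pentachoron.tet_coeff[OF P' d'(2)]
      pentachoron.tet_coeff[OF P d'(3)] pentachoron.tet_coeff[OF P' d'(3)]
    by (simp_all add: lin insert_commute)
  show ?thesis
  proof (cases "t \<in> {u, v}")
    case True
    then show ?thesis
      using uv pentachoron.comp_e_zero[OF P uv] pentachoron.comp_e_zero[OF P' uv] by auto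
  next
    case False
    then have "u \<in> {i, j, k, l}" "v \<in> {i, j, k, l}" using vertex_UNIV[OF d] by blast+
    then show ?thesis using uv g eqs by (auto simp: insert_commute)
  qed
qed

text \<open>The form on \<open>V\<^sub>t\<close> is determined by its values \<open>p\<close> and
  \<open>q\<close> on two opposite edges. The coefficients fix only their ratio, so the map obtained
  is a similitude.\<close>

lemma transport_tetrahedron:
  assumes P: "pentachoron F e f a c" and P': "pentachoron F' e' f' a c"
  shows "\<exists>g s. (\<forall>u v. u \<noteq> v \<longrightarrow> g *v comp_op t (e {u, v}) = comp_op t (e' {u, v}) \<and>
                     g *v comp_op t (f {u, v}) = comp_op t (f' {u, v})) \<and>
           s \<noteq> 0 \<and> (\<forall>x y. sympl (g *v x) (g *v y) = s * sympl x y)"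
proof -
  interpret X: pentachoron F e f a c by (rule P)
  interpret Y: pentachoron F' e' f' a c by (rule P')
  obtain i j k l where d: "distinct [i, j, k, l, t]" by (rule obtain_vertices1)
  have d1: "distinct [k, l, i, j, t]" and d2: "distinct [i, k, j, l, t]" and d3: "distinct [j, i, l, k, t]"
    using d by auto
  obtain g where g: "g *v comp_op t (e {i, j}) = comp_op t (e' {i, j})"
    "g *v comp_op t (f {i, j}) = comp_op t (f' {i, j})"
    "g *v comp_op t (e {k, l}) = comp_op t (e' {k, l})"
    "g *v comp_op t (f {k, l}) = comp_op t (f' {k, l})"
    using tet_op_basis_extend[OF X.opposite_basis[OF d]] by blast
  define p where "p = sympl (comp_op t (e {i, j})) (comp_op t (f {i, j}))"
  define q where "q = sympl (comp_op t (e {k, l})) (comp_op t (f {k, l}))"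
  define p' where "p' = sympl (comp_op t (e' {i, j})) (comp_op t (f' {i, j}))"
  define q' where "q' = sympl (comp_op t (e' {k, l})) (comp_op t (f' {k, l}))"
  have p: "p \<noteq> 0" "p' \<noteq> 0" and q: "q \<noteq> 0"
    unfolding p_def p'_def q_def
    by (rule X.sympl_edge_nonzero[OF d] Y.sympl_edge_nonzero[OF d] X.sympl_edge_nonzero[OF d1])+
  define s where "s = p' / p"
  have p's: "p' = s * p" using p by (simp add: s_def)
  \<comment> \<open>Orthogonality of the opposite edges \<open>ik\<close> and \<open>jl\<close> is a
    linear relation between \<open>p\<close> and \<open>q\<close> with coefficients from
    \<open>a\<close> and \<open>c\<close>; the same relation holds for \<open>p'\<close> and
    \<open>q'\<close>.\<close>
  have q's: "q' = s * q"
  proof -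
    note lin = sympl_add_left sympl_add_right sympl_scale_left sympl_scale_right
    have "coeff1 a i j k l * coeff1 c j i l k * p + coeff2 a i j k l * coeff2 c j i l k * q = 0"
      using X.orthogonal(2)[OF d2] X.orthogonal(2)[OF d] X.orthogonal(2)[OF d1]
      unfolding X.tet_coeff[OF d] X.sw.tet_coeff[OF d3]
      by (simp add: lin p_def q_def insert_commute ac_simps)
    moreover have "coeff1 a i j k l * coeff1 c j i l k * p' + coeff2 a i j k l * coeff2 c j i l k * q' = 0"
      using Y.orthogonal(2)[OF d2] Y.orthogonal(2)[OF d] Y.orthogonal(2)[OF d1]
      unfolding Y.tet_coeff[OF d] Y.sw.tet_coeff[OF d3]
      by (simp add: lin p'_def q'_def insert_commute ac_simps)
    ultimately have "coeff2 a i j k l * coeff2 c j i l k * q' = coeff2 a i j k l * coeff2 c j i l k * (s * q)"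
      using p's by algebra
    then show ?thesis
      using X.coeff2_nonzero[OF d] X.sw.coeff2_nonzero[OF d3] by simp
  qed
  have scale: "sympl (g *v x) (g *v y) = s * sympl x y" for x y
  proof -
    obtain x1 x2 x3 x4 where x: "x = x1 *s comp_op t (e {i, j}) + x2 *s comp_op t (f {i, j})
             + x3 *s comp_op t (e {k, l}) + x4 *s comp_op t (f {k, l})"
      using tet_op_basis_span[OF X.opposite_basis[OF d]] by blast
    obtain y1 y2 y3 y4 where y: "y = y1 *s comp_op t (e {i, j}) + y2 *s comp_op t (f {i, j})
             + y3 *s comp_op t (e {k, l}) + y4 *s comp_op t (f {k, l})"
      using tet_op_basis_span[OF X.opposite_basis[OF d]] by blast
    note lin = sympl_add_left sympl_add_right sympl_scale_left sympl_scale_right sympl_self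
    have X': "sympl (comp_op t (f {i, j})) (comp_op t (e {i, j})) = - p"
      "sympl (comp_op t (f {k, l})) (comp_op t (e {k, l})) = - q"
      unfolding p_def q_def by (rule sympl_commute)+
    have Y': "sympl (comp_op t (f' {i, j})) (comp_op t (e' {i, j})) = - p'"
      "sympl (comp_op t (f' {k, l})) (comp_op t (e' {k, l})) = - q'"
      unfolding p'_def q'_def by (rule sympl_commute)+
    have "sympl x y = (x1 * y2 - x2 * y1) * p + (x3 * y4 - x4 * y3) * q"
      unfolding x y lin X' X.orthogonal[OF d] X.orthogonal[OF d1] p_def[symmetric] q_def[symmetric]
      by (simp add: algebra_simps)
    moreover have "sympl (g *v x) (g *v y) = (x1 * y2 - x2 * y1) * p' + (x3 * y4 - x4 * y3) * q'"
      unfolding x y matrix_vector_right_distrib vec.scale g lin Y' Y.orthogonal[OF d] Y.orthogonal[OF d1]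
        p'_def[symmetric] q'_def[symmetric]
      by (simp add: algebra_simps)
    ultimately show ?thesis unfolding p's q's by algebra
  qed
  have "g *v comp_op t (e {u, v}) = comp_op t (e' {u, v})" "g *v comp_op t (f {u, v}) = comp_op t (f' {u, v})"
    if "u \<noteq> v" for u v
    using transport_edges[OF P P' d that g(1,3)]
      transport_edges[OF X.swap Y.swap d that g(2,4)] by simp_all
  moreover have "s \<noteq> 0" using p by (simp add: s_def)
  ultimately show ?thesis using scale by blast
qed

lemma gauge_equivalent_if_same_coefficients:
  assumes P: "pentachoron F e f a c" and P': "pentachoron F' e' f' a c"
  shows "gauge_equivalent (V_L F) (V_L F')"
proof -
  interpret X: pentachoron F e f a c by (rule P)
  interpret Y: pentachoron F' e' f' a c by (rule P')
  have "\<forall>t. \<exists>g s. (\<forall>u v. u \<noteq> v \<longrightarrow> g *v comp_op t (e {u, v}) = comp_op t (e' {u, v}) \<and>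
                     g *v comp_op t (f {u, v}) = comp_op t (f' {u, v})) \<and>
           s \<noteq> 0 \<and> (\<forall>x y. sympl (g *v x) (g *v y) = s * sympl x y)"
    using transport_tetrahedron[OF P P'] by blast
  then obtain g s where g: "\<And>t u v. u \<noteq> v \<Longrightarrow> g t *v comp_op t (e {u, v}) = comp_op t (e' {u, v})"
      "\<And>t u v. u \<noteq> v \<Longrightarrow> g t *v comp_op t (f {u, v}) = comp_op t (f' {u, v})"
    and s: "\<And>t. s t \<noteq> 0" "\<And>t x y. sympl (g t *v x) (g t *v y) = s t * sympl x y"
    by metis
  \<comment> \<open>The adjacent edges \<open>ij\<close> and \<open>ik\<close> have opposite
    products at \<open>l\<close> and \<open>t\<close> in both pentachora, and these products are
    nonzero.\<close>
  have same: "s l = s t" if lt: "l \<noteq> t" for l t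
  proof -
    obtain i j k where d: "distinct [i, j, k, l, t]" using obtain_vertices2[OF lt] .
    then have ne: "i \<noteq> j" "i \<noteq> k" and d': "distinct [i, j, k, t, l]" by auto
    have "sympl (comp_op l (e {i, j})) (comp_op l (f {i, k})) =
        - sympl (comp_op t (e {i, j})) (comp_op t (f {i, k}))"
      using ne by (intro adjacent_edges_isotropic[OF X.sym d] X.e_in X.f_in)
    moreover have "sympl (comp_op l (e' {i, j})) (comp_op l (f' {i, k})) =
        - sympl (comp_op t (e' {i, j})) (comp_op t (f' {i, k}))"
      using ne by (intro adjacent_edges_isotropic[OF Y.sym d] Y.e_in Y.f_in)
    moreover have "sympl (comp_op v (e' {i, j})) (comp_op v (f' {i, k})) =
        s v * sympl (comp_op v (e {i, j})) (comp_op v (f {i, k}))" for v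
      using s(2)[of v "comp_op v (e {i, j})" "comp_op v (f {i, k})"] ne by (simp add: g)
    ultimately show ?thesis
      using X.sympl_adjacent_nonzero[OF d] by simp
  qed
  define \<kappa> where "\<kappa> = s 0"
  have s_eq: "s t = \<kappa>" for t using same[of t 0] by (cases "t = 0") (simp_all add: \<kappa>_def)
  have \<kappa>: "\<kappa> \<noteq> 0" using s(1) by (simp add: \<kappa>_def)
  \<comment> \<open>A uniform factor preserves the coefficients \<open>a\<close> and divides every
    product of an \<open>e'\<close> with an \<open>f'\<close> by \<kappa>, so the similitudes onto
    the rescaled data have factor 1.\<close>
  define e2 where "e2 = (\<lambda>b. (1 / \<kappa>) *s e' b)"
  have P2: "pentachoron F' e2 f' a c"
    unfolding e2_def by (rule Y.rescale[where m = "\<lambda>_. 1 / \<kappa>"]) (use \<kappa> in simp_all)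
  have "\<exists>h. (\<forall>u v. u \<noteq> v \<longrightarrow> h *v comp_op t (e {u, v}) = comp_op t (e2 {u, v}) \<and>
                     h *v comp_op t (f {u, v}) = comp_op t (f' {u, v})) \<and> h \<in> Sp4" for t
  proof -
    obtain h r where h: "\<And>u v. u \<noteq> v \<Longrightarrow> h *v comp_op t (e {u, v}) = comp_op t (e2 {u, v}) \<and>
                     h *v comp_op t (f {u, v}) = comp_op t (f' {u, v})"
      and r: "\<And>x y. sympl (h *v x) (h *v y) = r * sympl x y"
      using transport_tetrahedron[OF P P2, of t] by blast
    obtain i j k l where d: "distinct [i, j, k, l, t]" by (rule obtain_vertices1)
    then have ne: "i \<noteq> j" by auto
    have "r * sympl (comp_op t (e {i, j})) (comp_op t (f {i, j})) =
        sympl (comp_op t (e2 {i, j})) (comp_op t (f' {i, j}))"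
      using r[of "comp_op t (e {i, j})" "comp_op t (f {i, j})"] h[OF ne] by simp
    also have "\<dots> = 1 / \<kappa> * sympl (comp_op t (e' {i, j})) (comp_op t (f' {i, j}))"
      by (simp add: e2_def comp_op_scale sympl_scale_left)
    also have "\<dots> = sympl (comp_op t (e {i, j})) (comp_op t (f {i, j}))"
      using s(2)[of t "comp_op t (e {i, j})" "comp_op t (f {i, j})"] \<kappa> ne by (simp add: g s_eq)
    finally have "r = 1" using X.sympl_edge_nonzero[OF d] by simp
    then have "h \<in> Sp4" using r by (simp add: Sp4_def)
    then show ?thesis using h by blast
  qed
  then obtain h where h: "\<And>t u v. u \<noteq> v \<Longrightarrow> h t *v comp_op t (e {u, v}) = comp_op t (e2 {u, v})"
      "\<And>t u v. u \<noteq> v \<Longrightarrow> h t *v comp_op t (f {u, v}) = comp_op t (f' {u, v})"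
    and Sp: "\<And>t. h t \<in> Sp4"
    by metis
  have act: "gauge_action h (e {u, v}) = e2 {u, v}" "gauge_action h (f {u, v}) = f' {u, v}" if "u \<noteq> v" for u v
    using h that by (auto intro!: pent_op_eqI simp: gauge_action_apply)
  have "gauge_action h ` V_L F = vec.span (gauge_action h ` {x. \<exists>i j. i \<noteq> j \<and> (x = e {i, j} \<or> x = f {i, j})})"
    unfolding X.V_L_eq_span by (rule vec.linear_span_image[OF gauge_action_linear, symmetric])
  also have "gauge_action h ` {x. \<exists>i j. i \<noteq> j \<and> (x = e {i, j} \<or> x = f {i, j})} =
      {x. \<exists>i j. i \<noteq> j \<and> (x = e2 {i, j} \<or> x = f' {i, j})}"
    using act by (auto simp: image_iff) metis+
  also have "vec.span \<dots> = V_L F'"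
    by (rule pentachoron.V_L_eq_span[OF P2, symmetric])
  finally show ?thesis
    unfolding gauge_equivalent_def using Sp by blast
qed

text \<open>The first cohomology of the simplex is trivial: cochains with the same coboundary differ by
  a rescaling of the relations (\<open>m\<close>) and of the edge vectors (\<open>L\<close>).\<close>

lemma cochain_rescale:
  fixes a a' :: "vertex \<Rightarrow> vertex \<Rightarrow> complex"
  assumes nz: "\<And>i j. i \<noteq> j \<Longrightarrow> a i j \<noteq> 0" "\<And>i j. i \<noteq> j \<Longrightarrow> a' i j \<noteq> 0"
    and hol: "\<And>i j k. i \<noteq> j \<Longrightarrow> j \<noteq> k \<Longrightarrow> i \<noteq> k \<Longrightarrow> triangle_hol a i j k = triangle_hol a' i j k"
  obtains L m where "\<And>b. L b \<noteq> 0" "\<And>i. m i \<noteq> 0" "\<And>i j. i \<noteq> j \<Longrightarrow> a i j * L {i, j} = m i * a' i j"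
proof -
  \<comment> \<open>With \<open>m 0 = 1\<close> these values are forced by requiring
    \<open>l i 0 = l 0 i\<close>.\<close>
  define m where "m = (\<lambda>i. if i = 0 then 1 else (a i 0 * a' 0 i) / (a' i 0 * a 0 i))"
  have m: "m i \<noteq> 0" for i using nz by (simp add: m_def)
  define l where "l = (\<lambda>i j. m i * a' i j / a i j)"
  \<comment> \<open>Away from vertex 0 this is the equality of the holonomies of the triangle
    \<open>i j 0\<close>.\<close>
  have sym: "l i j = l j i" if "i \<noteq> j" for i j
  proof -
    consider "i = 0" | "j = 0" | "i \<noteq> 0" "j \<noteq> 0" by blast
    then have "m i * a' i j * a j i = m j * a' j i * a i j"
    proof cases
      case 3
      have "triangle_hol a i j 0 = triangle_hol a' i j 0" using that 3 by (intro hol)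
      then have "a j 0 * a 0 i * a i j * (a' j i * a' 0 j * a' i 0) = a' j 0 * a' 0 i * a' i j * (a j i * a 0 j * a i 0)"
        using nz that 3 by (simp add: triangle_hol_def field_simps)
      then show ?thesis
        using nz that 3 by (simp add: m_def field_simps)
    qed (use nz that in \<open>simp_all add: m_def field_simps\<close>)
    then show ?thesis using nz that by (simp add: l_def field_simps)
  qed
  \<comment> \<open>On sets that are not edges, the value 1 keeps \<open>L\<close> nonzero
    everywhere.\<close>
  have "\<exists>x. x \<noteq> 0 \<and> (\<forall>i j. i \<noteq> j \<longrightarrow> b = {i, j} \<longrightarrow> x = l i j)" for b
  proof (cases "\<exists>i j. i \<noteq> j \<and> b = {i, j}")
    case True
    then obtain i j where ij: "i \<noteq> j" "b = {i, j}" by blast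
    then show ?thesis
      using m nz sym by (intro exI[of _ "l i j"]) (auto simp: l_def doubleton_eq_iff)
  qed (auto intro: exI[of _ 1])
  then obtain L where "\<And>b. L b \<noteq> 0" "\<And>b i j. i \<noteq> j \<Longrightarrow> b = {i, j} \<Longrightarrow> L b = l i j"
    by metis
  then show ?thesis
    using m nz by (intro that[of L m]) (simp_all add: l_def)
qed

section \<open>From matrix relations and cocycles to scalar data\<close>

lemma diagonal_matrix_mult:
  fixes P Q :: "complex^2^2"
  assumes "diagonal_matrix P" "diagonal_matrix Q"
  shows "diagonal_matrix (P ** Q)" "(P ** Q) $ r $ r = P $ r $ r * Q $ r $ r"
  using assms exhaust_2[of r]
  by (auto simp: diagonal_matrix_def matrix_matrix_mult_def sum_2 forall_2)

lemma diagonal_matrix_inv: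
  fixes P :: "complex^2^2"
  assumes P: "diagonal_matrix P" "invertible P"
  shows "P $ r $ r \<noteq> 0" "diagonal_matrix (matrix_inv P)" "matrix_inv P $ r $ r = inverse (P $ r $ r)"
proof -
  have off: "P $ 1 $ 2 = 0" "P $ 2 $ 1 = 0"
    using P(1) by (auto simp: diagonal_matrix_def)
  have "det P \<noteq> 0" using P(2) by (simp add: invertible_det_nz)
  then have nz: "P $ 1 $ 1 \<noteq> 0" "P $ 2 $ 2 \<noteq> 0" by (auto simp: det_2 off)
  then show "P $ r $ r \<noteq> 0" using exhaust_2[of r] by auto
  have "P ** matrix_inv P = mat 1"
    using P(2) unfolding invertible_def matrix_inv_def by (rule someI2_ex) simp
  then have eq: "(P ** matrix_inv P) $ i $ j = (if i = j then 1 else 0)" for i j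
    by (simp add: mat_def)
  have "P $ i $ i * matrix_inv P $ i $ j = (if i = j then 1 else 0)" for i j
    using eq[of i j] exhaust_2[of i] by (auto simp: matrix_matrix_mult_def sum_2 off)
  from this[of 1 1] this[of 1 2] this[of 2 1] this[of 2 2] nz
  have "matrix_inv P $ 1 $ 1 = inverse (P $ 1 $ 1)" "matrix_inv P $ 1 $ 2 = 0"
    "matrix_inv P $ 2 $ 1 = 0" "matrix_inv P $ 2 $ 2 = inverse (P $ 2 $ 2)"
    by (auto simp: field_simps)
  then show "diagonal_matrix (matrix_inv P)" "matrix_inv P $ r $ r = inverse (P $ r $ r)"
    using exhaust_2[of r] by (auto simp: diagonal_matrix_def forall_2)
qed

lemma span_pair_iff:
  fixes u v :: pent_op
  shows "x \<in> vec.span {u, v} \<longleftrightarrow> (\<exists>p q. x = p *s u + q *s v)"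
  by (simp add: vec.span_breakdown_eq) (metis add_diff_cancel_left' diff_add_cancel add.commute diff_eq_eq)

text \<open>The cocycle records only the holonomy of \<open>a\<close>; that of \<open>c\<close> is
  recovered later from \<open>triangle_hol_inverse\<close>.\<close>

lemma has_cocycle_pentachoron:
  assumes F: "F \<in> symmetric_matrices" "opposite_edges_independent F" "no_nonzero_flow F"
    and coc: "has_cocycle F \<omega>"
  obtains e f a c where "pentachoron F e f a c"
    "\<And>i j k. i \<noteq> j \<Longrightarrow> j \<noteq> k \<Longrightarrow> i \<noteq> k \<Longrightarrow> triangle_hol a i j k = \<omega> i j k"
proof -
  obtain e f A where bases: "edge_bases F e f" and rel: "vertex_relations e f A"
    and hol: "\<And>i j k. i \<noteq> j \<Longrightarrow> j \<noteq> k \<Longrightarrow> i \<noteq> k \<Longrightarrow>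
           mat_col (holonomy A i j k) (edge_col e f i j) $ 1 = \<omega> i j k *s e {i, j}"
    using coc unfolding has_cocycle_def by blast
  define a where "a = (\<lambda>i j. A i j $ 1 $ 1)"
  define c where "c = (\<lambda>i j. A i j $ 2 $ 2)"
  have A: "diagonal_matrix (A i j)" "invertible (A i j)" if "i \<noteq> j" for i j
    using rel that by (auto simp: vertex_relations_def)
  have base: "e {i, j} \<noteq> f {i, j}" "vec.independent {e {i, j}, f {i, j}}"
    "vec.span {e {i, j}, f {i, j}} = edge_space F {i, j}" if "i \<noteq> j" for i j
    using bases that by (auto simp: edge_bases_def)
  have col: "edge_col e f i j $ 1 = e {i, j}" "edge_col e f i j $ 2 = f {i, j}" for i j
    by (simp_all add: edge_col_def vector_def)
  have P: "pentachoron F e f a c"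
  proof (rule pentachoron.intro)
    show "e {i, j} \<in> edge_space F {i, j}" if "i \<noteq> j" for i j
      using base(3)[OF that] vec.span_base[of "e {i, j}" "{e {i, j}, f {i, j}}"] by simp
    show "f {i, j} \<in> edge_space F {i, j}" if "i \<noteq> j" for i j
      using base(3)[OF that] vec.span_base[of "f {i, j}" "{e {i, j}, f {i, j}}"] by simp
    show "x = 0 \<and> y = 0" if ij: "i \<noteq> j" and eq: "x *s e {i, j} + y *s f {i, j} = 0" for i j x y
    proof -
      let ?u = "\<lambda>v. if v = e {i, j} then x else y"
      have "(\<Sum>v\<in>{e {i, j}, f {i, j}}. ?u v *s v) = 0"
        using eq base(1)[OF ij] by simp
      then have "?u v = 0" if "v \<in> {e {i, j}, f {i, j}}" for v
        using vec.independentD[OF base(2)[OF ij] _ subset_refl, of ?u v] that by simp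
      from this[of "e {i, j}"] this[of "f {i, j}"] show ?thesis
        using base(1)[OF ij] by (auto split: if_splits)
    qed
    show "\<exists>x y. d = x *s e {i, j} + y *s f {i, j}" if "i \<noteq> j" "d \<in> edge_space F {i, j}" for i j d
      using that base(3) by (simp flip: span_pair_iff)
    show "a i j \<noteq> 0" "c i j \<noteq> 0" if "i \<noteq> j" for i j
      using diagonal_matrix_inv(1)[OF A[OF that]] by (simp_all add: a_def c_def)
    have comp: "(\<Sum>j\<in>- {i}. mat_col (A i j) (edge_col e f i j) $ r) = 0" for i r
      using rel by (simp add: vertex_relations_def flip: sum_component)
    have "mat_col (A i j) (edge_col e f i j) $ 1 = a i j *s e {i, j}"
      "mat_col (A i j) (edge_col e f i j) $ 2 = c i j *s f {i, j}" if "j \<in> - {i}" for i j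
      using A(1)[of i j] that by (auto simp: mat_col_def sum_2 col a_def c_def diagonal_matrix_def)
    then show "(\<Sum>j\<in>- {i}. a i j *s e {i, j}) = 0" "(\<Sum>j\<in>- {i}. c i j *s f {i, j}) = 0" for i
      using comp[of i 1] comp[of i 2] by simp_all
  qed (fact F)+
  moreover have "triangle_hol a i j k = \<omega> i j k" if ijk: "i \<noteq> j" "j \<noteq> k" "i \<noteq> k" for i j k
  proof -
    note ne = ijk ijk[symmetric]
    note D = A(1)[OF ne(2)] A(1)[OF ne(6)] A(1)[OF ne(1)]
      diagonal_matrix_inv(2)[OF A[OF ne(4)]] diagonal_matrix_inv(2)[OF A[OF ne(5)]]
      diagonal_matrix_inv(2)[OF A[OF ne(3)]]
    have "diagonal_matrix (holonomy A i j k)"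
      unfolding holonomy_def by (intro diagonal_matrix_mult(1) D)
    then have "mat_col (holonomy A i j k) (edge_col e f i j) $ 1 = holonomy A i j k $ 1 $ 1 *s e {i, j}"
      by (simp add: mat_col_def sum_2 col diagonal_matrix_def)
    also have "holonomy A i j k $ 1 $ 1 = triangle_hol a i j k"
      unfolding holonomy_def triangle_hol_def a_def
      using ne by (simp add: diagonal_matrix_mult D diagonal_matrix_inv(3)[OF A])
    finally have "triangle_hol a i j k *s e {i, j} = \<omega> i j k *s e {i, j}"
      unfolding hol[OF ijk] by (rule sym)
    \<comment> \<open>The eigenvalue is determined because \<open>e {i, j}\<close> is nonzero; a
      zero multiple of \<open>f {i, j}\<close> is added to match \<open>indep\<close>.\<close>
    then have "(triangle_hol a i j k - \<omega> i j k) *s e {i, j} + 0 *s f {i, j} = 0"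
      by (simp add: vec.scale_left_diff_distrib)
    then show ?thesis
      using pentachoron.indep[OF P ijk(1)] by (metis eq_iff_diff_eq_0)
  qed
  ultimately show ?thesis by (rule that)
qed

lemma gauge_equivalent_if_same_cocycle:
  assumes P: "pentachoron F e f a c" and P': "pentachoron F' e' f' a' c'"
    and hol: "\<And>i j k. i \<noteq> j \<Longrightarrow> j \<noteq> k \<Longrightarrow> i \<noteq> k \<Longrightarrow> triangle_hol a i j k = triangle_hol a' i j k"
  shows "gauge_equivalent (V_L F) (V_L F')"
proof -
  have hol': "triangle_hol c i j k = triangle_hol c' i j k" if "i \<noteq> j" "j \<noteq> k" "i \<noteq> k" for i j k
  proof -
    obtain l t where d: "distinct [i, j, k, l, t]"
      using obtain_vertices3[OF \<open>i \<noteq> j\<close> \<open>j \<noteq> k\<close> \<open>i \<noteq> k\<close>] .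
    show ?thesis
      using hol[OF that] pentachoron.triangle_hol_inverse[OF P d] pentachoron.triangle_hol_inverse[OF P' d]
      by simp
  qed
  obtain L m where L: "\<And>b. L b \<noteq> 0" "\<And>i. m i \<noteq> 0" "\<And>i j. i \<noteq> j \<Longrightarrow> a i j * L {i, j} = m i * a' i j"
    using cochain_rescale[of a a'] pentachoron.a_nz[OF P] pentachoron.a_nz[OF P'] hol by blast
  obtain M n where M: "\<And>b. M b \<noteq> 0" "\<And>i. n i \<noteq> 0" "\<And>i j. i \<noteq> j \<Longrightarrow> c i j * M {i, j} = n i * c' i j"
    using cochain_rescale[of c c'] pentachoron.c_nz[OF P] pentachoron.c_nz[OF P'] hol' by blast
  \<comment> \<open>First \<open>e'\<close> is rescaled to change \<open>a'\<close> into
    \<open>a\<close>; then, with the roles exchanged, \<open>f'\<close> is rescaled to change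
    \<open>c'\<close> into \<open>c\<close>.\<close>
  have "pentachoron F' (\<lambda>b. L b *s e' b) f' a c'"
    by (rule pentachoron.rescale[where m = m]) (use P' L in auto)
  then have "pentachoron F' f' (\<lambda>b. L b *s e' b) c' a"
    by (rule pentachoron.swap)
  then have "pentachoron F' (\<lambda>b. M b *s f' b) (\<lambda>b. L b *s e' b) c a"
    by (rule pentachoron.rescale[where m = n]) (use M in auto)
  then have "pentachoron F' (\<lambda>b. L b *s e' b) (\<lambda>b. M b *s f' b) a c"
    by (rule pentachoron.swap)
  with P show ?thesis by (rule gauge_equivalent_if_same_coefficients)
qed

theorem theorem4:
  shows "\<exists>U :: (complex^var^var) set. zariski_open_sym U \<and> U \<noteq> {} \<and>
    (\<forall>F\<in>U. \<forall>F'\<in>U. \<forall>\<omega>. has_cocycle F \<omega> \<and> has_cocycle F' \<omega> \<longrightarrow>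
       gauge_equivalent (V_L F) (V_L F'))"
proof -
  obtain p :: "complex^var^var \<Rightarrow> complex" where p: "poly_fun matrix_entries p"
    "\<exists>F\<in>symmetric_matrices. p F \<noteq> 0"
    "\<And>F. F \<in> symmetric_matrices \<Longrightarrow> p F \<noteq> 0 \<Longrightarrow> opposite_edges_independent F \<and> no_nonzero_flow F"
    using generic_conj[OF generic_opposite_edges_independent generic_no_nonzero_flow]
    unfolding generic_def by blast
  let ?U = "{F \<in> symmetric_matrices. \<exists>q\<in>{p}. q F \<noteq> 0}"
  have "zariski_open_sym ?U" unfolding zariski_open_sym_def using p(1) by blast
  moreover have "?U \<noteq> {}" using p(2) by auto
  moreover have "gauge_equivalent (V_L F) (V_L F')"
    if "F \<in> ?U" "F' \<in> ?U" "has_cocycle F \<omega>" "has_cocycle F' \<omega>" for F F' \<omega>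
  proof -
    have F: "F \<in> symmetric_matrices" "opposite_edges_independent F" "no_nonzero_flow F"
      and F': "F' \<in> symmetric_matrices" "opposite_edges_independent F'" "no_nonzero_flow F'"
      using that(1,2) p(3) by auto
    obtain e f a c where P: "pentachoron F e f a c"
      "\<And>i j k. i \<noteq> j \<Longrightarrow> j \<noteq> k \<Longrightarrow> i \<noteq> k \<Longrightarrow> triangle_hol a i j k = \<omega> i j k"
      using has_cocycle_pentachoron[OF F \<open>has_cocycle F \<omega>\<close>] by blast
    obtain e' f' a' c' where P': "pentachoron F' e' f' a' c'"
      "\<And>i j k. i \<noteq> j \<Longrightarrow> j \<noteq> k \<Longrightarrow> i \<noteq> k \<Longrightarrow> triangle_hol a' i j k = \<omega> i j k"
      using has_cocycle_pentachoron[OF F' \<open>has_cocycle F' \<omega>\<close>] by blast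
    show ?thesis
      by (rule gauge_equivalent_if_same_cocycle[OF P(1) P'(1)]) (simp add: P(2) P'(2))
  qed
  ultimately show ?thesis by blast
qed

end
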